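(* Let $\Omega$ be an open set in $\mathbb{R}^n$ which contains balls of arbitrarily large radius, and let $1<p<\infty$. Let $$Au=\nabla^t(\mathscr{A}\nabla u)+\mathbf{b}\nabla u+au$$ be a differential operator with constant complex coefficients ($\mathscr{A}\in\mathbb{C}^{n\times n}$, $\mathbf{b}\in\mathbb{C}^n$, $a\in\mathbb{C}$), where the matrix $\mathscr{A}$ is symmetric ($\mathscr{A}^t=\mathscr{A}$). The operator $A$ is $L^p$-dissipative if and only if there exists a real constant vector $V\in\mathbb{R}^n$ such that $$2\operatorname{Re}\mathscr{A}\,V+\operatorname{Im}\mathbf{b}=0,\qquad \operatorname{Re}a+\langle \operatorname{Re}\mathscr{A}\,V,V\rangle\leq 0,$$ and the inequality $$|p-2|\,|\langle \operatorname{Im}\mathscr{A}\,\xi,\xi\rangle|\leq 2\sqrt{p-1}\,\langle \operatorname{Re}\mathscr{A}\,\xi,\xi\rangle$$ holds for any $\xi\in\mathbb{R}^n$.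
   Context: $\nabla^t$ is the divergence operator, $\mathbf{b}\nabla u=\sum_j b_j\partial_j u$; $\langle\cdot,\cdot\rangle$ is the inner product in $\mathbb{C}^n$ or $\mathbb{C}$ (conjugate-linear in the second entry). $\operatorname{Re}$ and $\operatorname{Im}$ of matrices and vectors are taken entrywise. $C_0^1(\Omega)$ is the space of complex valued $C^1$ functions with compact support in $\Omega$. $L^p$-dissipativity of $A$ means $L^p$-dissipativity of the associated sesquilinear form $$\mathscr{L}(u,v)=\int_\Omega\big(\langle \mathscr{A}\nabla u,\nabla v\rangle-\langle \mathbf{b}\nabla u,v\rangle-a\langle u,v\rangle\big)dx,\qquad u,v\in C_0^1(\Omega),$$ that is, with $p'=p/(p-1)$, for all $u\in C_0^1(\Omega)$: $\operatorname{Re}\mathscr{L}(u,|u|^{p-2}u)\geq 0$ if $p\geq 2$; $\operatorname{Re}\mathscr{L}(|u|^{p'-2}u,u)\geq 0$ if $1<p<2$. *)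

theory Defs
  imports "HOL-Analysis.Analysis"
begin

definition partial_deriv :: "'n::finite \<Rightarrow> (real^'n \<Rightarrow> complex) \<Rightarrow> real^'n \<Rightarrow> complex" where
  "partial_deriv j u x = frechet_derivative u (at x) (axis j 1)"

definition grad :: "(real^'n::finite \<Rightarrow> complex) \<Rightarrow> real^'n \<Rightarrow> complex^'n" where
  "grad u x = (\<chi> j. partial_deriv j u x)"

text \<open>Functions in \<open>C_0^1(\<Omega>)\<close> are represented by their extension by zero to the whole space;
  since the support is a compact subset of \<open>\<Omega>\<close>, that extension is again of class \<open>C^1\<close>.\<close>

definition C01 :: "(real^'n::finite) set \<Rightarrow> (real^'n \<Rightarrow> complex) set" where
  "C01 \<Omega> = {u. (\<forall>x. u differentiable (at x)) \<and>
               (\<forall>j. continuous_on UNIV (partial_deriv j u)) \<and>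
               compact (closure {x. u x \<noteq> 0}) \<and> closure {x. u x \<noteq> 0} \<subseteq> \<Omega>}"

text \<open>The Hermitian inner product, conjugate-linear in the second entry; the library's
  \<open>\<bullet>\<close> on \<open>complex^'n\<close> is only its real part.\<close>

definition cinner_vec :: "complex^'n::finite \<Rightarrow> complex^'n \<Rightarrow> complex" where
  "cinner_vec z w = (\<Sum>j\<in>UNIV. z $ j * cnj (w $ j))"

definition Re_mat :: "complex^'n^'m \<Rightarrow> real^'n^'m" where
  "Re_mat A = (\<chi> i j. Re (A $ i $ j))"

definition Im_mat :: "complex^'n^'m \<Rightarrow> real^'n^'m" where
  "Im_mat A = (\<chi> i j. Im (A $ i $ j))"

definition Im_vec :: "complex^'n \<Rightarrow> real^'n" where
  "Im_vec b = (\<chi> j. Im (b $ j))"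

text \<open>The sesquilinear form of the operator \<open>u \<mapsto> \<nabla>\<^sup>t(A \<nabla>u) + b \<nabla>u + a u\<close> with constant
  coefficients.\<close>

definition sesq_form ::
  "(real^'n::finite) set \<Rightarrow> complex^'n^'n \<Rightarrow> complex^'n \<Rightarrow> complex \<Rightarrow>
   (real^'n \<Rightarrow> complex) \<Rightarrow> (real^'n \<Rightarrow> complex) \<Rightarrow> complex" where
  "sesq_form \<Omega> A b a u v =
     (LINT x:\<Omega>|lborel. cinner_vec (A *v grad u x) (grad v x)
        - (\<Sum>j\<in>UNIV. b $ j * partial_deriv j u x) * cnj (v x)
        - a * (u x * cnj (v x)))"

text \<open>The function \<open>|u|^(q-2) u\<close>. It vanishes wherever \<open>u\<close> does, so the convention
  \<open>0 powr 0 = 0\<close> is harmless: for \<open>q = 2\<close> it is \<open>u\<close> itself.\<close>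

definition duality_map :: "real \<Rightarrow> (real^'n::finite \<Rightarrow> complex) \<Rightarrow> real^'n \<Rightarrow> complex" where
  "duality_map q u x = complex_of_real (cmod (u x) powr (q - 2)) * u x"

definition Lp_dissipative_form ::
  "real \<Rightarrow> (real^'n::finite) set \<Rightarrow>
   ((real^'n \<Rightarrow> complex) \<Rightarrow> (real^'n \<Rightarrow> complex) \<Rightarrow> complex) \<Rightarrow> bool" where
  "Lp_dissipative_form p \<Omega> L \<longleftrightarrow>
     (\<forall>u\<in>C01 \<Omega>.
        (2 \<le> p \<longrightarrow> 0 \<le> Re (L u (duality_map p u))) \<and>
        (1 < p \<and> p < 2 \<longrightarrow> 0 \<le> Re (L (duality_map (p / (p - 1)) u) u)))"

definition Lp_dissipative ::
  "real \<Rightarrow> (real^'n::finite) set \<Rightarrow> complex^'n^'n \<Rightarrow> complex^'n \<Rightarrow> complex \<Rightarrow> bool" where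
  "Lp_dissipative p \<Omega> A b a \<longleftrightarrow> Lp_dissipative_form p \<Omega> (sesq_form \<Omega> A b a)"

end

theory Submission
  imports Defs
begin

text \<open>Put \<open>q = max p p'\<close>, \<open>\<rho> = |u|\<close> and \<open>X + iY = cnj (sgn u) \<nabla>u\<close>. In both cases of the definition the
  real part of the integrand is \<open>\<rho>\<^bsup>q-2\<^esup>\<close> times
  \<open>(q-1) RX\<cdot>X + RY\<cdot>Y - (q-2) SX\<cdot>Y + \<rho> \<beta>\<cdot>Y - \<rho> B\<cdot>X - \<alpha>\<rho>\<^sup>2\<close>, with \<open>R = Re A\<close>, \<open>\<beta> = Im b\<close>,
  \<open>\<alpha> = Re a\<close>, and \<open>S = Im A\<close>, \<open>B = Re b\<close> if \<open>p \<ge> 2\<close>, but \<open>S = - Im A\<close>, \<open>B = (q-1) Re b\<close> if \<open>p < 2\<close>.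

  Sufficiency: complete the square with \<open>V\<close>; what remains is a nonnegative quadratic form and
  multiples of \<open>\<rho>\<^bsup>q-1\<^esup> X = \<nabla>(\<rho>\<^sup>q)/q\<close>, whose integral vanishes.

  Necessity: a wide bump times \<open>exp (i \<eta>\<cdot>x)\<close> gives \<open>R\<eta>\<cdot>\<eta> + \<beta>\<cdot>\<eta> - \<alpha> \<ge> 0\<close> for all \<open>\<eta>\<close>, hence \<open>V\<close>. A fixed bump
  times \<open>(2 + cos (t \<xi>\<cdot>x + \<delta>))\<close> to the complex power \<open>(1 + i\<mu>) 2/q\<close> gives, as \<open>t \<rightarrow> \<infinity>\<close>,
  \<open>(q - 1 + \<mu>\<^sup>2) R\<xi>\<cdot>\<xi> - (q-2) \<mu> S\<xi>\<cdot>\<xi> \<ge> 0\<close>, and \<open>\<mu> = \<plusminus> sqrt (q-1)\<close> is the stated inequality.\<close>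

section \<open>Functions of class C1 with compact support\<close>

lemma partial_deriv_eq:
  assumes "(u has_derivative D) (at x)"
  shows "partial_deriv j u x = D (axis j 1)"
  using frechet_derivative_at[OF assms] by (simp add: partial_deriv_def)

lemma linear_eq_sum_axis:
  fixes D :: "real^'n::finite \<Rightarrow> complex"
  assumes "linear D"
  shows "D h = (\<Sum>j\<in>UNIV. (h $ j) *\<^sub>R D (axis j 1))"
proof -
  have "D h = D (\<Sum>j\<in>UNIV. (h $ j) *\<^sub>R axis j 1)"
    using basis_expansion[of h] by (simp add: scalar_mult_eq_scaleR)
  then show ?thesis
    using assms by (simp add: linear_sum linear_scale)
qed

lemma C01_has_derivative:
  assumes "u \<in> C01 \<Omega>"
  shows "(u has_derivative (\<lambda>h. \<Sum>j\<in>UNIV. (h $ j) *\<^sub>R partial_deriv j u x)) (at x)"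
proof -
  have d: "(u has_derivative frechet_derivative u (at x)) (at x)"
    using assms by (simp add: C01_def frechet_derivative_works)
  have "frechet_derivative u (at x) = (\<lambda>h. \<Sum>j\<in>UNIV. (h $ j) *\<^sub>R partial_deriv j u x)"
    unfolding partial_deriv_def by (rule ext, rule linear_eq_sum_axis[OF has_derivative_linear[OF d]])
  with d show ?thesis by simp
qed

lemma C01_continuous:
  assumes "u \<in> C01 \<Omega>"
  shows "continuous_on UNIV u"
  by (intro continuous_at_imp_continuous_on ballI has_derivative_continuous[OF C01_has_derivative[OF assms]])

lemma C01_continuous_partial_deriv: "u \<in> C01 \<Omega> \<Longrightarrow> continuous_on UNIV (partial_deriv j u)"
  by (simp add: C01_def)

text \<open>The compact set \<open>K\<close> need only contain the set where \<open>u\<close> is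
  nonzero: being closed, it also contains the closure, which is then compact as a closed subset of
  \<open>K\<close>.\<close>

lemma C01_I:
  assumes d: "\<And>x. (u has_derivative D x) (at x)"
    and c: "\<And>j. continuous_on UNIV (\<lambda>x. D x (axis j 1))"
    and K: "compact K" "K \<subseteq> \<Omega>" "\<And>x. x \<notin> K \<Longrightarrow> u x = 0"
  shows "u \<in> C01 \<Omega>"
proof -
  have pd: "partial_deriv j u = (\<lambda>x. D x (axis j 1))" for j
    using partial_deriv_eq[OF d] by auto
  have "closure {x. u x \<noteq> 0} \<subseteq> K"
    by (rule closure_minimal) (use K compact_imp_closed in auto)
  moreover from this have "compact (closure {x. u x \<noteq> 0})"
    using K(1) compact_Int_closed[of K "closure {x. u x \<noteq> 0}"] by (simp add: inf.absorb2)
  moreover have "u differentiable (at x)" for x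
    using d by (rule differentiableI)
  moreover have "continuous_on UNIV (partial_deriv j u)" for j
    unfolding pd by (rule c)
  ultimately show ?thesis
    using K(2) unfolding C01_def by blast
qed

definition supp :: "(real^'n::finite \<Rightarrow> complex) \<Rightarrow> (real^'n) set" where
  "supp u = closure {x. u x \<noteq> 0}"

lemma C01_supp: "u \<in> C01 \<Omega> \<Longrightarrow> compact (supp u)" "u \<in> C01 \<Omega> \<Longrightarrow> supp u \<subseteq> \<Omega>"
  by (auto simp: C01_def supp_def)

lemma not_in_supp: "x \<notin> supp u \<Longrightarrow> u x = 0"
  using closure_subset[of "{x. u x \<noteq> 0}"] by (auto simp: supp_def)

text \<open>The complement of \<open>supp u\<close> is open, so \<open>u\<close> vanishes on a whole
  neighbourhood of \<open>x\<close>; vanishing at \<open>x\<close> alone would not determine the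
  derivative.\<close>

lemma partial_deriv_not_in_supp:
  assumes "x \<notin> supp u"
  shows "partial_deriv j u x = 0"
proof -
  have "(u has_derivative (\<lambda>h. 0)) (at x)"
  proof (rule has_derivative_transform_within_open)
    show "((\<lambda>x. 0) has_derivative (\<lambda>h. 0)) (at x)" by simp
    show "open (- supp u)" by (simp add: supp_def open_Compl del: closure_complement interior_complement)
  qed (use assms not_in_supp in auto)
  from partial_deriv_eq[OF this] show ?thesis .
qed

section \<open>Integration of compactly supported functions and of their derivatives\<close>

lemma integrable_continuous_compact_support:
  fixes g :: "real^'n::finite \<Rightarrow> 'b::{banach, second_countable_topology}"
  assumes "continuous_on UNIV g" "compact K" "\<And>x. x \<notin> K \<Longrightarrow> g x = 0"
  shows "integrable lborel g"
proof -
  have "integrable lborel (\<lambda>x. indicator K x *\<^sub>R g x)"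
    using assms by (intro borel_integrable_compact) (auto intro: continuous_on_subset)
  also have "(\<lambda>x. indicator K x *\<^sub>R g x) = g"
    using assms(3) by (auto simp: indicator_def)
  finally show ?thesis .
qed

lemma bounded_continuous_compact_support:
  fixes g :: "real^'n::finite \<Rightarrow> 'b::real_normed_vector"
  assumes "continuous_on UNIV g" "compact K" "\<And>x. x \<notin> K \<Longrightarrow> g x = 0"
  obtains B where "B \<ge> 0" "\<And>x. norm (g x) \<le> B"
proof -
  have "compact (g ` K)"
    using assms by (intro compact_continuous_image) (auto intro: continuous_on_subset)
  then obtain B where B: "\<And>y. y \<in> g ` K \<Longrightarrow> norm y \<le> B"
    using compact_imp_bounded bounded_iff by metis
  \<comment> \<open>For empty \<open>K\<close> the bound \<open>B\<close> is arbitrary and may be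
    negative, hence the maximum with 0.\<close>
  have "norm (g x) \<le> max B 0" for x
    by (cases "x \<in> K") (use B assms(3) in \<open>auto simp: le_max_iff_disj\<close>)
  then show ?thesis using that[of "max B 0"] by auto
qed

lemma C01_integrable_partial_deriv:
  assumes "w \<in> C01 \<Omega>"
  shows "integrable lborel (partial_deriv j w)"
  by (rule integrable_continuous_compact_support[OF C01_continuous_partial_deriv[OF assms]
        C01_supp(1)[OF assms] partial_deriv_not_in_supp])

lemma integrable_lborel_translate:
  fixes g :: "real^'n::finite \<Rightarrow> complex"
  assumes "integrable lborel g"
  shows "integrable lborel (\<lambda>x. g (t + x))" "integral\<^sup>L lborel (\<lambda>x. g (t + x)) = integral\<^sup>L lborel g"
proof -
  have g: "g \<in> borel_measurable borel" using borel_measurable_integrable[OF assms] by simp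
  have "integrable (distr lborel borel ((+) t)) g" using assms by (simp add: lborel_distr_plus)
  then show "integrable lborel (\<lambda>x. g (t + x))"
    by (subst (asm) integrable_distr_eq) (use g in auto)
  have "integral\<^sup>L (distr lborel borel ((+) t)) g = integral\<^sup>L lborel (\<lambda>x. g (t + x))"
    by (rule integral_distr) (use g in auto)
  then show "integral\<^sup>L lborel (\<lambda>x. g (t + x)) = integral\<^sup>L lborel g"
    by (simp add: lborel_distr_plus)
qed

text \<open>By translation invariance the difference quotients of \<open>w\<close> integrate to zero; dominated
  convergence passes this to the derivative.\<close>

lemma integral_partial_deriv_eq_0:
  fixes w :: "real^'n::finite \<Rightarrow> complex"
  assumes w: "w \<in> C01 \<Omega>"
  shows "integral\<^sup>L lborel (partial_deriv j w) = 0"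
proof -
  define e :: "real^'n" where "e = axis j 1"
  have [simp]: "norm e = 1" by (simp add: e_def)
  obtain B where B: "B \<ge> 0" "\<And>x. norm (partial_deriv j w x) \<le> B"
    using bounded_continuous_compact_support[of "partial_deriv j w" "supp w"]
      C01_continuous_partial_deriv[OF w] C01_supp(1)[OF w] partial_deriv_not_in_supp by blast
  \<comment> \<open>The steps \<open>t n\<close> are at most 1, so every difference quotient
    vanishes outside this closed 1-neighbourhood of the support. The mean value inequality bounds it
    by \<open>B\<close>, which yields an integrable majorant.\<close>
  define K where "K = {x + y | x y. x \<in> supp w \<and> y \<in> cball (0::real^'n) 1}"
  have K: "compact K" unfolding K_def
    using compact_sums[OF C01_supp(1)[OF w] compact_cball[of 0 1]] by simp
  have wint: "integrable lborel w"
    by (rule integrable_continuous_compact_support[OF C01_continuous[OF w] C01_supp(1)[OF w]]) (rule not_in_supp)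
  have line: "((\<lambda>s. w (x + s *\<^sub>R e)) has_vector_derivative partial_deriv j w (x + s *\<^sub>R e)) (at s)"
    for x s
  proof -
    have "((\<lambda>s. w (x + s *\<^sub>R e)) has_derivative
       (\<lambda>h. \<Sum>k\<in>UNIV. ((h *\<^sub>R e) $ k) *\<^sub>R partial_deriv k w (x + s *\<^sub>R e))) (at s)"
      by (rule has_derivative_compose[OF _ C01_has_derivative[OF w]]) (auto intro!: derivative_eq_intros)
    moreover have "(\<Sum>k\<in>UNIV. ((h *\<^sub>R e) $ k) *\<^sub>R partial_deriv k w (x + s *\<^sub>R e))
        = h *\<^sub>R partial_deriv j w (x + s *\<^sub>R e)" for h
    proof -
      have "(\<Sum>k\<in>UNIV. ((h *\<^sub>R e) $ k) *\<^sub>R partial_deriv k w (x + s *\<^sub>R e))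
        = (\<Sum>k\<in>UNIV. if k = j then h *\<^sub>R partial_deriv k w (x + s *\<^sub>R e) else 0)"
        by (intro sum.cong) (auto simp: e_def axis_def)
      then show ?thesis by simp
    qed
    ultimately show ?thesis by (simp add: has_vector_derivative_def)
  qed
  define t :: "nat \<Rightarrow> real" where "t n = inverse (real (Suc n))" for n
  have t: "t n > 0" "t n \<le> 1" for n
    by (auto simp: t_def divide_simps)
  define Q where "Q n x = (w (t n *\<^sub>R e + x) - w x) /\<^sub>R t n" for n x
  have "(\<lambda>n. integral\<^sup>L lborel (Q n)) \<longlonglongrightarrow> integral\<^sup>L lborel (partial_deriv j w)"
  proof (rule integral_dominated_convergence[where w = "\<lambda>x. indicator K x *\<^sub>R B"])
    show "partial_deriv j w \<in> borel_measurable lborel"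
      using borel_measurable_integrable[OF C01_integrable_partial_deriv[OF w]] .
    show "Q n \<in> borel_measurable lborel" for n
      unfolding Q_def
      using borel_measurable_integrable[OF wint]
        borel_measurable_integrable[OF integrable_lborel_translate(1)[OF wint]]
      by measurable
    show "integrable lborel (\<lambda>x. indicator K x *\<^sub>R B)"
      by (rule borel_integrable_compact) (use K in auto)
    show "AE x in lborel. (\<lambda>n. Q n x) \<longlonglongrightarrow> partial_deriv j w x"
    proof (rule AE_I2)
      fix x :: "real^'n"
      have "((\<lambda>s. w (x + s *\<^sub>R e)) has_vector_derivative partial_deriv j w x) (at 0)"
        using line[of x 0] by simp
      note dl = this
      have lim: "((\<lambda>h. (w (x + h *\<^sub>R e) - w x) /\<^sub>R h) \<longlongrightarrow> partial_deriv j w x) (at 0)"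
      proof -
        from dl have l: "((\<lambda>h. norm (w (x + h *\<^sub>R e) - w x - h *\<^sub>R partial_deriv j w x) / norm h) \<longlongrightarrow> 0) (at 0)"
          by (simp add: has_vector_derivative_def has_derivative_at)
        have "((\<lambda>h. norm ((w (x + h *\<^sub>R e) - w x) /\<^sub>R h - partial_deriv j w x)) \<longlongrightarrow> 0) (at 0)"
        proof (rule Lim_transform_eventually[OF l])
          have "norm (w (x + h *\<^sub>R e) - w x - h *\<^sub>R partial_deriv j w x) / norm h =
            norm ((w (x + h *\<^sub>R e) - w x) /\<^sub>R h - partial_deriv j w x)" if "h \<noteq> 0" for h
          proof -
            have "(w (x + h *\<^sub>R e) - w x) /\<^sub>R h - partial_deriv j w x
              = (w (x + h *\<^sub>R e) - w x - h *\<^sub>R partial_deriv j w x) /\<^sub>R h"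
              using that by (simp add: scaleR_right_diff_distrib)
            then show ?thesis by (simp add: divide_inverse_commute)
          qed
          then show "\<forall>\<^sub>F h in at 0. norm (w (x + h *\<^sub>R e) - w x - h *\<^sub>R partial_deriv j w x) / norm h =
            norm ((w (x + h *\<^sub>R e) - w x) /\<^sub>R h - partial_deriv j w x)"
            by (auto simp: eventually_at_filter)
        qed
        then show ?thesis by (simp add: tendsto_norm_zero_iff LIM_zero_iff)
      qed
      have "t \<longlonglongrightarrow> 0" unfolding t_def by (rule LIMSEQ_inverse_real_of_nat)
      then have "filterlim t (at 0) sequentially"
        by (rule filterlim_atI) (use t(1) in \<open>auto intro!: always_eventually simp: less_imp_neq[THEN not_sym]\<close>)
      from filterlim_compose[OF lim this] show "(\<lambda>n. Q n x) \<longlonglongrightarrow> partial_deriv j w x"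
        by (simp add: Q_def add.commute)
    qed
    show "AE x in lborel. norm (Q n x) \<le> indicator K x *\<^sub>R B" for n
    proof (rule AE_I2)
      fix x :: "real^'n"
      have "norm (w (x + t n *\<^sub>R e) - w (x + 0 *\<^sub>R e)) \<le> B * norm (t n - 0)"
      proof (rule differentiable_bound[where S = UNIV and f = "\<lambda>s. w (x + s *\<^sub>R e)"])
        show "((\<lambda>s. w (x + s *\<^sub>R e)) has_derivative (\<lambda>h. h *\<^sub>R partial_deriv j w (x + s *\<^sub>R e)))
           (at s within UNIV)" for s
          using line[of x s] by (simp add: has_vector_derivative_def)
        show "onorm (\<lambda>h. h *\<^sub>R partial_deriv j w (x + s *\<^sub>R e)) \<le> B" for s
          by (rule onorm_le) (use B in \<open>auto simp: mult.commute[of B] intro!: mult_left_mono\<close>)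
      qed auto
      then have le: "norm (Q n x) \<le> B"
        using t(1)[of n] by (simp add: Q_def add.commute[of x] pos_divide_le_eq divide_inverse_commute[symmetric])
      show "norm (Q n x) \<le> indicator K x *\<^sub>R B"
      proof (cases "x \<in> K")
        case False
        have "x + 0 \<in> K" if "x \<in> supp w"
          unfolding K_def using that by (intro CollectI exI conjI) auto
        with False have "x \<notin> supp w" by auto
        moreover have "t n *\<^sub>R e + x \<notin> supp w"
        proof
          assume "t n *\<^sub>R e + x \<in> supp w"
          then have "(t n *\<^sub>R e + x) + (- (t n *\<^sub>R e)) \<in> K"
            unfolding K_def using t[of n]
            by (intro CollectI exI[of _ "t n *\<^sub>R e + x"] exI[of _ "- (t n *\<^sub>R e)"] conjI) auto
          with False show False by simp
        qed
        ultimately show ?thesis using False by (simp add: Q_def not_in_supp)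
      qed (use le in simp)
    qed
  qed
  moreover have "integral\<^sup>L lborel (Q n) = 0" for n
    using integrable_lborel_translate[OF wint, of "t n *\<^sub>R e"] wint
    unfolding Q_def by simp
  ultimately show ?thesis
    by (simp add: LIMSEQ_const_iff)
qed

section \<open>The duality map\<close>

text \<open>Away from 0 this is the product rule. At 0 the difference quotient has modulus
  |h|^(q-2), which tends to 0 because q > 2; the formula also gives 0 there, since
  \<open>0 powr _ = 0\<close>.\<close>

lemma has_derivative_cmod_powr_mult:
  fixes z :: complex
  assumes "q > 2"
  shows "((\<lambda>z. complex_of_real (cmod z powr (q - 2)) * z) has_derivative
    (\<lambda>h. complex_of_real (cmod z powr (q - 2)) * (h + complex_of_real ((q - 2) * (sgn z \<bullet> h)) * sgn z)))
    (at z)"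
proof (cases "z = 0")
  case True
  have "((\<lambda>h. cmod h powr (q - 2)) \<longlongrightarrow> cmod 0 powr (q - 2)) (at (0::complex))"
    using assms by (intro tendsto_powr' tendsto_intros) (auto intro!: always_eventually)
  then have l: "((\<lambda>h. cmod h powr (q - 2)) \<longlongrightarrow> 0) (at (0::complex))"
    using assms by simp
  have "((\<lambda>h. norm (complex_of_real (cmod h powr (q - 2)) * h) / norm h) \<longlongrightarrow> 0) (at (0::complex))"
    by (rule Lim_transform_eventually[OF l]) (auto simp: eventually_at_filter norm_mult)
  then show ?thesis using True by (simp add: has_derivative_at)
next
  case False
  have "((\<lambda>z. cmod z powr (q - 2)) has_derivative
     (\<lambda>h. (sgn z \<bullet> h) * ((q - 2) * cmod z powr (q - 2 - 1)))) (at z)"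
    using has_derivative_compose[OF has_derivative_norm[OF False],
        OF has_field_derivative_imp_has_derivative[OF has_real_derivative_powr[of "cmod z" "q - 2"]]] False
    by (simp add: inner_commute[of "sgn z"] mult.commute)
  then have "((\<lambda>z. complex_of_real (cmod z powr (q - 2)) * z) has_derivative
     (\<lambda>h. complex_of_real (cmod z powr (q - 2)) * h +
       complex_of_real ((sgn z \<bullet> h) * ((q - 2) * cmod z powr (q - 2 - 1))) * z)) (at z)"
    by (intro has_derivative_mult has_derivative_of_real has_derivative_ident)
  moreover have "complex_of_real (cmod z powr (q - 2)) * h +
       complex_of_real ((sgn z \<bullet> h) * ((q - 2) * cmod z powr (q - 2 - 1))) * z
     = complex_of_real (cmod z powr (q - 2)) * (h + complex_of_real ((q - 2) * (sgn z \<bullet> h)) * sgn z)" for h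
  proof -
    have "cmod z powr (q - 2) = cmod z powr (q - 2 - 1) * cmod z"
      using False powr_add[of "cmod z" "q - 2 - 1" 1] by simp
    moreover have "z = complex_of_real (cmod z) * sgn z"
      using False by (simp add: sgn_div_norm scaleR_conv_of_real)
    ultimately have "complex_of_real (cmod z powr (q - 2)) * sgn z = complex_of_real (cmod z powr (q - 2 - 1)) * z"
      by (metis of_real_mult mult.assoc)
    then show ?thesis
      by (simp add: distrib_left mult_ac)
  qed
  ultimately show ?thesis by simp
qed

lemma duality_map_2 [simp]: "duality_map 2 u = u"
  by (auto simp: duality_map_def powr_def)

lemma duality_map_has_derivative:
  assumes "q > 2" "(u has_derivative D) (at x)"
  shows "(duality_map q u has_derivative (\<lambda>h. complex_of_real (cmod (u x) powr (q - 2)) *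
      (D h + complex_of_real ((q - 2) * (sgn (u x) \<bullet> D h)) * sgn (u x)))) (at x)"
  using has_derivative_compose[OF assms(2) has_derivative_cmod_powr_mult[OF assms(1)]]
  by (simp add: duality_map_def[abs_def])

text \<open>The last hypothesis excludes zeros of \<open>u\<close> when q = 2: there the factor
  \<open>0 powr 0\<close> is 0, whereas \<open>duality_map 2 u\<close> is \<open>u\<close>, whose
  derivative may be nonzero.\<close>

lemma partial_deriv_duality_map:
  assumes "q \<ge> 2" "u \<in> C01 \<Omega>" "q > 2 \<or> u x \<noteq> 0"
  shows "partial_deriv j (duality_map q u) x = complex_of_real (cmod (u x) powr (q - 2)) *
     (partial_deriv j u x + complex_of_real ((q - 2) * (sgn (u x) \<bullet> partial_deriv j u x)) * sgn (u x))"
proof (cases "q > 2")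
  case True
  have d: "(u has_derivative frechet_derivative u (at x)) (at x)"
    using assms(2) by (simp add: C01_def frechet_derivative_works)
  show ?thesis
    using partial_deriv_eq[OF duality_map_has_derivative[OF True d]]
    by (simp add: partial_deriv_def)
next
  case False
  then have "q = 2" using assms(1) by simp
  then show ?thesis using assms(3) by (simp add: powr_def)
qed

text \<open>At a zero of \<open>u\<close> the function \<open>sgn\<close> jumps, but the bracket
  stays below (q-1)|w| in modulus and the power in front tends to 0. In the application
  \<open>w\<close> is a partial derivative of \<open>u\<close>.\<close>

lemma continuous_cmod_powr_sgn:
  fixes u w :: "'a::t2_space \<Rightarrow> complex"
  assumes "q > 2" "continuous_on UNIV u" "continuous_on UNIV w"
  shows "continuous_on UNIV (\<lambda>x. complex_of_real (cmod (u x) powr (q - 2)) *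
      (w x + complex_of_real ((q - 2) * (sgn (u x) \<bullet> w x)) * sgn (u x)))" (is "continuous_on _ ?g")
proof -
  have "isCont ?g x" for x
  proof -
    have u: "(u \<longlongrightarrow> u x) (at x)" and w: "(w \<longlongrightarrow> w x) (at x)"
      using assms by (auto simp: continuous_on_def)
    have pw: "((\<lambda>x. cmod (u x) powr (q - 2)) \<longlongrightarrow> cmod (u x) powr (q - 2)) (at x)"
      using assms(1) by (intro tendsto_powr' tendsto_intros u) (auto intro!: always_eventually)
    show "isCont ?g x" unfolding isCont_def
    proof (cases "u x = 0")
      case False
      then show "(?g \<longlongrightarrow> ?g x) (at x)"
        by (intro tendsto_intros pw w tendsto_sgn u)
    next
      case True
      have "((\<lambda>x. cmod (u x) powr (q - 2) * ((q - 1) * cmod (w x))) \<longlongrightarrow>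
          cmod (u x) powr (q - 2) * ((q - 1) * cmod (w x))) (at x)"
        by (intro tendsto_intros pw w)
      then have l: "((\<lambda>x. cmod (u x) powr (q - 2) * ((q - 1) * cmod (w x))) \<longlongrightarrow> 0) (at x)"
        using True by simp
      have b: "norm (?g y) \<le> cmod (u y) powr (q - 2) * ((q - 1) * cmod (w y))" for y
      proof -
        have "cmod (complex_of_real ((q - 2) * (sgn (u y) \<bullet> w y)) * sgn (u y))
           = (q - 2) * (\<bar>sgn (u y) \<bullet> w y\<bar> * cmod (sgn (u y)))"
          using assms(1) by (simp add: norm_mult abs_mult del: of_real_mult of_real_diff)
        also have "\<dots> \<le> (q - 2) * (cmod (w y) * 1)"
          using assms(1) Cauchy_Schwarz_ineq2[of "sgn (u y)" "w y"]
          by (intro mult_left_mono mult_mono) (auto simp: norm_sgn split: if_splits)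
        finally have "cmod (w y + complex_of_real ((q - 2) * (sgn (u y) \<bullet> w y)) * sgn (u y))
            \<le> (q - 1) * cmod (w y)"
          using norm_triangle_ineq[of "w y" "complex_of_real ((q - 2) * (sgn (u y) \<bullet> w y)) * sgn (u y)"]
          by (simp add: algebra_simps)
        then show ?thesis by (simp add: norm_mult mult_left_mono)
      qed
      have "(?g \<longlongrightarrow> 0) (at x)"
        by (rule Lim_null_comparison[OF always_eventually l]) (use b in blast)
      then show "(?g \<longlongrightarrow> ?g x) (at x)" using True by simp
    qed
  qed
  then show ?thesis by (simp add: continuous_at_imp_continuous_on)
qed

lemma C01_duality_map:
  assumes "q \<ge> 2" "u \<in> C01 \<Omega>"
  shows "duality_map q u \<in> C01 \<Omega>"
proof (cases "q > 2")
  case True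
  have d: "(u has_derivative frechet_derivative u (at x)) (at x)" for x
    using assms(2) by (simp add: C01_def frechet_derivative_works)
  show ?thesis
  proof (rule C01_I[OF duality_map_has_derivative[OF True d]])
    show "continuous_on UNIV (\<lambda>x. complex_of_real (cmod (u x) powr (q - 2)) *
        (frechet_derivative u (at x) (axis j 1) +
          complex_of_real ((q - 2) * (sgn (u x) \<bullet> frechet_derivative u (at x) (axis j 1))) * sgn (u x)))" for j
      using continuous_cmod_powr_sgn[OF True C01_continuous[OF assms(2)]
          C01_continuous_partial_deriv[OF assms(2)], of j]
      by (simp add: partial_deriv_def)
    show "duality_map q u x = 0" if "x \<notin> supp u" for x
      using not_in_supp[OF that] by (simp add: duality_map_def)
  qed (use C01_supp[OF assms(2)] in auto)
next
  case False
  then have "q = 2" using assms(1) by simp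
  then show ?thesis using assms(2) by simp
qed

text \<open>Used with \<open>v = duality_map q u\<close>: the product is then |u|^q, whose partial
  derivatives integrate to zero.\<close>

lemma C01_mult_cnj:
  assumes "v \<in> C01 \<Omega>" "u \<in> C01 \<Omega>"
  shows "(\<lambda>x. v x * cnj (u x)) \<in> C01 \<Omega>"
    and "partial_deriv j (\<lambda>x. v x * cnj (u x)) x =
      partial_deriv j v x * cnj (u x) + v x * cnj (partial_deriv j u x)"
proof -
  have d: "(w has_derivative frechet_derivative w (at x)) (at x)" if "w \<in> C01 \<Omega>" for x w
    using that by (simp add: C01_def frechet_derivative_works)
  have D: "((\<lambda>x. v x * cnj (u x)) has_derivative (\<lambda>h. v x * cnj (frechet_derivative u (at x) h) +
     frechet_derivative v (at x) h * cnj (u x))) (at x)" for x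
    by (intro has_derivative_mult d assms has_derivative_cnj)
  show "(\<lambda>x. v x * cnj (u x)) \<in> C01 \<Omega>"
  proof (rule C01_I[OF D, of "supp u"])
    show "continuous_on UNIV (\<lambda>x. v x * cnj (frechet_derivative u (at x) (axis j 1)) +
         frechet_derivative v (at x) (axis j 1) * cnj (u x))" for j
      using C01_continuous[OF assms(1)] C01_continuous[OF assms(2)]
       C01_continuous_partial_deriv[OF assms(1), of j] C01_continuous_partial_deriv[OF assms(2), of j]
      unfolding partial_deriv_def by (intro continuous_intros)
  qed (use C01_supp[OF assms(2)] not_in_supp in auto)
  show "partial_deriv j (\<lambda>x. v x * cnj (u x)) x =
      partial_deriv j v x * cnj (u x) + v x * cnj (partial_deriv j u x)"
    using partial_deriv_eq[OF D] by (simp add: partial_deriv_def)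
qed

section \<open>The real part of the form as an integral over the whole space\<close>

definition form_integrand ::
  "complex^'n^'n \<Rightarrow> complex^'n \<Rightarrow> complex \<Rightarrow>
   (real^'n::finite \<Rightarrow> complex) \<Rightarrow> (real^'n \<Rightarrow> complex) \<Rightarrow> real^'n \<Rightarrow> complex" where
  "form_integrand A b a u v x = cinner_vec (A *v grad u x) (grad v x)
        - (\<Sum>j\<in>UNIV. b $ j * partial_deriv j u x) * cnj (v x) - a * (u x * cnj (v x))"

lemma integrable_form_integrand:
  assumes "u \<in> C01 \<Omega>" "v \<in> C01 \<Omega>"
  shows "integrable lborel (form_integrand A b a u v)"
proof (rule integrable_continuous_compact_support)
  show "continuous_on UNIV (form_integrand A b a u v)"
    unfolding form_integrand_def[abs_def] cinner_vec_def matrix_vector_mult_def grad_def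
    using C01_continuous[OF assms(1)] C01_continuous[OF assms(2)]
       C01_continuous_partial_deriv[OF assms(1)] C01_continuous_partial_deriv[OF assms(2)]
    by (auto intro!: continuous_intros)
  show "form_integrand A b a u v x = 0" if "x \<notin> supp u" for x
    using that not_in_supp[OF that] partial_deriv_not_in_supp[OF that]
    by (simp add: form_integrand_def cinner_vec_def matrix_vector_mult_def grad_def)
qed (use C01_supp assms in auto)

lemma Re_sesq_form:
  assumes "u \<in> C01 \<Omega>" "v \<in> C01 \<Omega>"
  shows "Re (sesq_form \<Omega> A b a u v) = integral\<^sup>L lborel (\<lambda>x. Re (form_integrand A b a u v x))"
proof -
  have "indicator \<Omega> x *\<^sub>R form_integrand A b a u v x = form_integrand A b a u v x" for x
  proof (cases "x \<in> \<Omega>")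
    case False
    then have *: "x \<notin> supp u" using C01_supp[OF assms(1)] by blast
    show ?thesis
      using not_in_supp[OF *] partial_deriv_not_in_supp[OF *]
      by (simp add: form_integrand_def cinner_vec_def matrix_vector_mult_def grad_def)
  qed simp
  then have "sesq_form \<Omega> A b a u v = integral\<^sup>L lborel (form_integrand A b a u v)"
    by (simp add: sesq_form_def set_lebesgue_integral_def form_integrand_def[symmetric] del: scaleR_conv_of_real)
  then show ?thesis
    by (simp add: integrable_form_integrand[OF assms])
qed

definition Re_vec :: "complex^'n \<Rightarrow> real^'n" where
  "Re_vec b = (\<chi> j. Re (b $ j))"

lemma Re_cinner_vec:
  fixes A :: "complex^'n::finite^'n"
  shows "Re (cinner_vec (A *v z) w) =
     (Re_mat A *v Re_vec z) \<bullet> Re_vec w + (Re_mat A *v Im_vec z) \<bullet> Im_vec w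
     + (Im_mat A *v Re_vec z) \<bullet> Im_vec w - (Im_mat A *v Im_vec z) \<bullet> Re_vec w"
  unfolding cinner_vec_def matrix_vector_mult_def Re_mat_def Im_mat_def Re_vec_def Im_vec_def
    inner_vec_def
  by (simp add: sum.distrib sum_subtractf algebra_simps)

text \<open>Both slots receive the same factor, conjugated in the second, and
  \<open>s * cnj s = 1\<close>. With \<open>s = sgn (u x)\<close> this removes the phase of
  \<open>u\<close> from the leading term.\<close>

lemma cinner_vec_unit_mult:
  fixes A :: "complex^'n::finite^'n"
  assumes "cmod s = 1"
  shows "cinner_vec (A *v (\<chi> j. s * z $ j)) (\<chi> j. s * w $ j) = cinner_vec (A *v z) w"
proof -
  have s: "s * cnj s = 1" using assms by (simp add: complex_norm_square[symmetric])
  have "(\<Sum>k\<in>UNIV. A $ j $ k * (s * z $ k)) * cnj (s * w $ j)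
     = (\<Sum>k\<in>UNIV. A $ j $ k * z $ k) * cnj (w $ j)" for j
  proof -
    have "(\<Sum>k\<in>UNIV. A $ j $ k * (s * z $ k)) = s * (\<Sum>k\<in>UNIV. A $ j $ k * z $ k)"
      by (simp add: sum_distrib_left mult.left_commute)
    then have "(\<Sum>k\<in>UNIV. A $ j $ k * (s * z $ k)) * cnj (s * w $ j)
       = (s * cnj s) * ((\<Sum>k\<in>UNIV. A $ j $ k * z $ k) * cnj (w $ j))"
      by simp
    then show ?thesis by (simp only: s) simp
  qed
  then show ?thesis by (simp only: cinner_vec_def matrix_vector_mult_def vec_lambda_beta)
qed

section \<open>The integrand in polar form\<close>

lemma symmetric_matrix_inner:
  fixes M :: "real^'n::finite^'n"
  assumes "transpose M = M"
  shows "(M *v x) \<bullet> y = (M *v y) \<bullet> x"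
  by (metis assms dot_lmul_matrix inner_commute transpose_matrix_vector)

text \<open>For u = \<rho> exp(i\<theta>) with \<rho> > 0, the real part is the gradient of \<rho>
  and the imaginary part is \<rho> times the gradient of \<theta>.\<close>

definition polar_grad :: "(real^'n::finite \<Rightarrow> complex) \<Rightarrow> real^'n \<Rightarrow> complex^'n" where
  "polar_grad u x = (\<chi> j. cnj (sgn (u x)) * partial_deriv j u x)"

definition radial_density where
  "radial_density q R S B \<beta> \<alpha> \<rho> X Y = \<rho> powr (q - 2) *
     ((q - 1) * ((R *v X) \<bullet> X) + (R *v Y) \<bullet> Y - (q - 2) * ((S *v X) \<bullet> Y)
       + \<rho> * (\<beta> \<bullet> Y) - \<rho> * (B \<bullet> X) - \<alpha> * \<rho>\<^sup>2)"

lemma sgn_mult_cnj: "u \<noteq> 0 \<Longrightarrow> sgn u * cnj (sgn u) = (1::complex)"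
  by (simp add: complex_norm_square[symmetric] norm_sgn)

lemma partial_deriv_polar:
  assumes "u x \<noteq> 0"
  shows "partial_deriv j u x = sgn (u x) * polar_grad u x $ j"
  using sgn_mult_cnj[OF assms] by (simp add: polar_grad_def mult.assoc[symmetric])

text \<open>Differentiating the factor |u|^(q-2) adds q-2 copies of the radial part to the one
  already present and leaves the phase part alone.\<close>

lemma partial_deriv_duality_map_polar:
  assumes "q \<ge> 2" "u \<in> C01 \<Omega>" "u x \<noteq> 0"
  shows "partial_deriv j (duality_map q u) x = sgn (u x) * (complex_of_real (cmod (u x) powr (q - 2)) *
     Complex ((q - 1) * Re (polar_grad u x $ j)) (Im (polar_grad u x $ j)))"
proof -
  have 1: "sgn (u x) \<bullet> partial_deriv j u x = Re (polar_grad u x $ j)"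
    by (simp add: polar_grad_def inner_complex_def)
  have 2: "Complex ((q - 1) * Re w) (Im w) = w + complex_of_real ((q - 2) * Re w)" for w
    by (simp add: complex_eq_iff algebra_simps)
  have "q > 2 \<or> u x \<noteq> 0" using assms(3) by simp
  from partial_deriv_duality_map[OF assms(1,2) this, of j] show ?thesis
    unfolding 1 2 unfolding partial_deriv_polar[where u = u and x = x, OF assms(3)]
    by (simp only: distrib_left mult_ac)
qed

lemma transpose_Im_mat: "transpose A = A \<Longrightarrow> transpose (Im_mat A) = Im_mat A"
  by (auto simp: transpose_def Im_mat_def vec_eq_iff)

lemma transpose_Re_mat: "transpose A = A \<Longrightarrow> transpose (Re_mat A) = Re_mat A"
  by (auto simp: transpose_def Re_mat_def vec_eq_iff)

lemma minus_matrix_vector_mult: "(- M) *v x = - (M *v (x::real^'n::finite))"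
  by (simp add: matrix_vector_mult_def vec_eq_iff sum_negf)

lemma Re_sum_mult:
  "Re (\<Sum>j\<in>UNIV. b $ j * w $ j) = Re_vec b \<bullet> Re_vec w - Im_vec b \<bullet> Im_vec w"
  by (simp add: Re_vec_def Im_vec_def inner_vec_def sum_subtractf)

lemma duality_map_polar:
  assumes "u x \<noteq> 0"
  shows "duality_map q u x = complex_of_real (cmod (u x) powr (q - 2) * cmod (u x)) * sgn (u x)"
  using assms by (simp add: duality_map_def sgn_div_norm scaleR_conv_of_real)

text \<open>Every term contains \<open>u x\<close>, its conjugate or a partial derivative of
  \<open>u\<close> as a factor, so the value of the gradient of \<open>duality_map q u\<close> at
  \<open>x\<close> is irrelevant.\<close>

lemma form_integrand_critical_zero:
  assumes "u x = 0" "\<And>j. partial_deriv j u x = 0"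
  shows "form_integrand A b a u (duality_map q u) x = 0"
    and "form_integrand A b a (duality_map q u) u x = 0"
  using assms
  by (simp_all add: form_integrand_def grad_def cinner_vec_def matrix_vector_mult_def duality_map_def)

text \<open>The product is |u|^q, with derivative q \<rho>^(q-1) times that of \<rho>: of the factor
  q, a share q-1 comes from \<open>duality_map q u\<close> and 1 from
  \<open>cnj (u x)\<close>.\<close>

lemma Re_partial_deriv_duality_map_mult_cnj:
  assumes q: "q \<ge> 2" and u: "u \<in> C01 \<Omega>"
  shows "Re (partial_deriv j (\<lambda>x. duality_map q u x * cnj (u x)) x) =
    q * (cmod (u x) powr (q - 2) * cmod (u x) * Re_vec (polar_grad u x) $ j)"
proof (cases "u x = 0")
  case True
  then show ?thesis
    using C01_mult_cnj(2)[OF C01_duality_map[OF q u] u, of j x] by (simp add: duality_map_def)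
next
  case ux: False
  let ?s = "sgn (u x)" and ?r = "cmod (u x)" and ?w = "polar_grad u x $ j"
  have ss: "?s * cnj ?s = 1" by (rule sgn_mult_cnj[OF ux])
  have ur: "u x = complex_of_real ?r * ?s"
    using ux by (simp add: sgn_div_norm scaleR_conv_of_real)
  have "partial_deriv j (duality_map q u) x * cnj (complex_of_real ?r * ?s)
    + duality_map q u x * cnj (partial_deriv j u x)
    = (?s * cnj ?s) * (complex_of_real (?r powr (q - 2) * ?r) * (Complex ((q - 1) * Re ?w) (Im ?w) + cnj ?w))"
    unfolding partial_deriv_duality_map_polar[OF q u ux] partial_deriv_polar[where u = u and x = x, OF ux]
      duality_map_polar[where u = u and x = x, OF ux]
    by (simp add: algebra_simps)
  then show ?thesis
    unfolding C01_mult_cnj(2)[OF C01_duality_map[OF q u] u] ss ur[symmetric]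
    by (simp add: Re_vec_def algebra_simps)
qed

context
  fixes A :: "complex^'n::finite^'n" and u :: "real^'n \<Rightarrow> complex" and q :: real
    and \<Omega> :: "(real^'n) set"
  assumes A: "transpose A = A" and q: "q \<ge> 2" and u: "u \<in> C01 \<Omega>"
begin

text \<open>The phase cancels in all three terms. The two cross terms with \<open>Im_mat A\<close>
  have weights 1 and -(q-1); symmetry of \<open>A\<close> merges them into -(q-2).\<close>

lemma Re_form_integrand_right:
  assumes ux: "u x \<noteq> 0"
  shows "Re (form_integrand A b a u (duality_map q u) x) =
    radial_density q (Re_mat A) (Im_mat A) (Re_vec b) (Im_vec b) (Re a) (cmod (u x))
      (Re_vec (polar_grad u x)) (Im_vec (polar_grad u x))"
proof -
  let ?s = "sgn (u x)" and ?r = "cmod (u x)" and ?w = "polar_grad u x"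
  define W where "W = (\<chi> j. complex_of_real (?r powr (q - 2)) * Complex ((q - 1) * Re (?w $ j)) (Im (?w $ j)))"
  have ns: "cmod ?s = 1" using ux by (simp add: norm_sgn)
  have ss: "?s * cnj ?s = 1" by (rule sgn_mult_cnj[OF ux])
  have W: "Re_vec W = (?r powr (q - 2) * (q - 1)) *\<^sub>R Re_vec ?w" "Im_vec W = (?r powr (q - 2)) *\<^sub>R Im_vec ?w"
    by (auto simp: W_def Re_vec_def Im_vec_def vec_eq_iff)
  have g: "grad u x = (\<chi> j. ?s * ?w $ j)"
    by (simp add: grad_def partial_deriv_polar[where u = u and x = x, OF ux])
  have gv: "grad (duality_map q u) x = (\<chi> j. ?s * W $ j)"
    by (simp add: grad_def partial_deriv_duality_map_polar[OF q u ux] W_def)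
  have 1: "Re (cinner_vec (A *v grad u x) (grad (duality_map q u) x)) =
     ?r powr (q - 2) * ((q - 1) * ((Re_mat A *v Re_vec ?w) \<bullet> Re_vec ?w)
        + (Re_mat A *v Im_vec ?w) \<bullet> Im_vec ?w - (q - 2) * ((Im_mat A *v Re_vec ?w) \<bullet> Im_vec ?w))"
    unfolding g gv cinner_vec_unit_mult[OF ns] Re_cinner_vec W inner_scaleR_right
    unfolding symmetric_matrix_inner[OF transpose_Im_mat[OF A], of "Im_vec ?w" "Re_vec ?w"]
    by (simp add: algebra_simps)
  have "(\<Sum>j\<in>UNIV. b $ j * partial_deriv j u x) * cnj (duality_map q u x)
      = (?s * cnj ?s) * (complex_of_real (?r powr (q - 2) * ?r) * (\<Sum>j\<in>UNIV. b $ j * ?w $ j))"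
    unfolding partial_deriv_polar[where u = u and x = x, OF ux] duality_map_polar[where u = u and x = x, OF ux]
    by (simp add: sum_distrib_left sum_distrib_right mult_ac)
  then have 2: "Re ((\<Sum>j\<in>UNIV. b $ j * partial_deriv j u x) * cnj (duality_map q u x))
      = ?r powr (q - 2) * ?r * (Re_vec b \<bullet> Re_vec ?w - Im_vec b \<bullet> Im_vec ?w)"
    unfolding ss mult_1 Re_sum_mult[symmetric] by simp
  have "u x = complex_of_real ?r * ?s"
    using ux by (simp add: sgn_div_norm scaleR_conv_of_real)
  then have "u x * cnj (duality_map q u x) = complex_of_real (?r powr (q - 2) * ?r * ?r) * (?s * cnj ?s)"
    unfolding duality_map_polar[where u = u and x = x, OF ux] by (simp add: mult_ac)
  then have 3: "Re (a * (u x * cnj (duality_map q u x))) = Re a * (?r powr (q - 2) * ?r\<^sup>2)"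
    unfolding ss by (simp add: power2_eq_square)
  show ?thesis
    unfolding form_integrand_def minus_complex.sel 1 2 3 radial_density_def
    by (simp add: algebra_simps power2_eq_square)
qed

text \<open>With the slots exchanged the cross terms have weights q-1 and -1, so their sum changes
  sign, hence \<open>- Im_mat A\<close>. The first order term now differentiates
  \<open>duality_map q u\<close>, which puts q-1 on \<open>Re_vec b\<close> but not on
  \<open>Im_vec b\<close>.\<close>

lemma Re_form_integrand_left:
  assumes ux: "u x \<noteq> 0"
  shows "Re (form_integrand A b a (duality_map q u) u x) =
    radial_density q (Re_mat A) (- Im_mat A) ((q - 1) *\<^sub>R Re_vec b) (Im_vec b) (Re a) (cmod (u x))
      (Re_vec (polar_grad u x)) (Im_vec (polar_grad u x))"
proof -
  let ?s = "sgn (u x)" and ?r = "cmod (u x)" and ?w = "polar_grad u x"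
  define W where "W = (\<chi> j. complex_of_real (?r powr (q - 2)) * Complex ((q - 1) * Re (?w $ j)) (Im (?w $ j)))"
  have ns: "cmod ?s = 1" using ux by (simp add: norm_sgn)
  have ss: "?s * cnj ?s = 1" by (rule sgn_mult_cnj[OF ux])
  have W: "Re_vec W = (?r powr (q - 2) * (q - 1)) *\<^sub>R Re_vec ?w" "Im_vec W = (?r powr (q - 2)) *\<^sub>R Im_vec ?w"
    by (auto simp: W_def Re_vec_def Im_vec_def vec_eq_iff)
  have g: "grad u x = (\<chi> j. ?s * ?w $ j)"
    by (simp add: grad_def partial_deriv_polar[where u = u and x = x, OF ux])
  have pv: "partial_deriv j (duality_map q u) x = ?s * W $ j" for j
    by (simp add: partial_deriv_duality_map_polar[OF q u ux] W_def)
  have gv: "grad (duality_map q u) x = (\<chi> j. ?s * W $ j)"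
    by (simp add: grad_def pv)
  have 1: "Re (cinner_vec (A *v grad (duality_map q u) x) (grad u x)) =
     ?r powr (q - 2) * ((q - 1) * ((Re_mat A *v Re_vec ?w) \<bullet> Re_vec ?w)
        + (Re_mat A *v Im_vec ?w) \<bullet> Im_vec ?w + (q - 2) * ((Im_mat A *v Re_vec ?w) \<bullet> Im_vec ?w))"
    unfolding g gv cinner_vec_unit_mult[OF ns] Re_cinner_vec W matrix_vector_mult_scaleR inner_scaleR_left
    unfolding symmetric_matrix_inner[OF transpose_Im_mat[OF A], of "Im_vec ?w" "Re_vec ?w"]
    by (simp add: algebra_simps)
  have ur: "u x = complex_of_real ?r * ?s"
    using ux by (simp add: sgn_div_norm scaleR_conv_of_real)
  have sum: "(\<Sum>j\<in>UNIV. b $ j * partial_deriv j (duality_map q u) x) * cnj (complex_of_real ?r * ?s)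
      = (?s * cnj ?s) * (complex_of_real ?r * (\<Sum>j\<in>UNIV. b $ j * W $ j))"
    unfolding pv
    by (simp add: sum_distrib_left sum_distrib_right mult_ac)
  have 2: "Re ((\<Sum>j\<in>UNIV. b $ j * partial_deriv j (duality_map q u) x) * cnj (u x))
      = ?r powr (q - 2) * ?r * ((q - 1) * (Re_vec b \<bullet> Re_vec ?w) - Im_vec b \<bullet> Im_vec ?w)"
  proof -
    have e: "Re (\<Sum>j\<in>UNIV. b $ j * W $ j)
        = ?r powr (q - 2) * ((q - 1) * (Re_vec b \<bullet> Re_vec ?w) - Im_vec b \<bullet> Im_vec ?w)"
      unfolding Re_sum_mult W by (simp add: algebra_simps)
    from sum have "Re ((\<Sum>j\<in>UNIV. b $ j * partial_deriv j (duality_map q u) x) * cnj (u x))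
      = ?r * Re (\<Sum>j\<in>UNIV. b $ j * W $ j)"
      unfolding ss mult_1 ur[symmetric] by (simp del: Re_sum)
    then show ?thesis unfolding e by (simp add: mult_ac)
  qed
  have "duality_map q u x * cnj (complex_of_real ?r * ?s) =
      complex_of_real (?r powr (q - 2) * ?r * ?r) * (?s * cnj ?s)"
    unfolding duality_map_polar[where u = u and x = x, OF ux] by (simp add: mult_ac)
  then have 3: "Re (a * (duality_map q u x * cnj (u x))) = Re a * (?r powr (q - 2) * ?r\<^sup>2)"
    unfolding ss ur[symmetric] by (simp add: power2_eq_square)
  show ?thesis
    unfolding form_integrand_def minus_complex.sel 1 2 3 radial_density_def
    by (simp add: algebra_simps power2_eq_square minus_matrix_vector_mult)
qed

text \<open>The polar formula fails at zeros of \<open>u\<close>. For q > 2 the integrand vanishes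
  there; for q = 2 it is the real part of the leading term, where symmetry of \<open>A\<close>
  cancels the contributions of \<open>Im_mat A\<close>.\<close>

lemma Re_form_integrand_zero_nonneg:
  assumes ux: "u x = 0" and R: "\<And>\<xi>. (Re_mat A *v \<xi>) \<bullet> \<xi> \<ge> 0"
  shows "Re (form_integrand A b a u (duality_map q u) x) \<ge> 0"
    and "Re (form_integrand A b a (duality_map q u) u x) \<ge> 0"
proof -
  have "Re (form_integrand A b a u (duality_map q u) x) \<ge> 0
    \<and> Re (form_integrand A b a (duality_map q u) u x) \<ge> 0"
  proof (cases "q > 2")
    case True
    then have "partial_deriv j (duality_map q u) x = 0" for j
      using partial_deriv_duality_map[OF q u, of x j] ux by simp
    then show ?thesis
      using ux by (simp add: form_integrand_def grad_def cinner_vec_def matrix_vector_mult_def duality_map_def)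
  next
    case False
    then have "q = 2" using q by simp
    moreover have "Re (cinner_vec (A *v grad u x) (grad u x)) \<ge> 0"
      unfolding Re_cinner_vec
        symmetric_matrix_inner[OF transpose_Im_mat[OF A], of "Im_vec (grad u x)" "Re_vec (grad u x)"]
      using R by simp
    ultimately show ?thesis using ux by (simp add: form_integrand_def)
  qed
  then show "Re (form_integrand A b a u (duality_map q u) x) \<ge> 0"
    "Re (form_integrand A b a (duality_map q u) u x) \<ge> 0" by auto
qed

end

section \<open>Test functions\<close>

lemma quadratic_form_nonneg:
  fixes R S :: "real^'n::finite^'n"
  assumes q: "q \<ge> 2" and R: "transpose R = R" and S: "transpose S = S"
    and ineq: "\<And>\<xi>. (q - 2) * \<bar>(S *v \<xi>) \<bullet> \<xi>\<bar> \<le> 2 * sqrt (q - 1) * ((R *v \<xi>) \<bullet> \<xi>)"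
  shows "0 \<le> (q - 1) * ((R *v X) \<bullet> X) + (R *v Z) \<bullet> Z - (q - 2) * ((S *v X) \<bullet> Z)"
proof -
  define c where "c = sqrt (q - 1)"
  have c: "c > 0" "c * c = q - 1" using q by (simp_all add: c_def)
  \<comment> \<open>Polarisation: the difference of the values of S at these vectors isolates the
    cross term, while the sum of the values of R has exactly the weights q-1 and 1, thanks to c^2 =
    q-1.\<close>
  let ?U = "c *\<^sub>R X + Z" and ?W = "c *\<^sub>R X - Z"
  have S': "(S *v ?U) \<bullet> ?U - (S *v ?W) \<bullet> ?W = 4 * c * ((S *v X) \<bullet> Z)"
    using symmetric_matrix_inner[OF S, of Z X]
    by (simp add: matrix_vector_right_distrib matrix_vector_mult_diff_distrib inner_add_left
        inner_add_right inner_diff_left inner_diff_right matrix_vector_mult_scaleR algebra_simps)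
  have R': "(R *v ?U) \<bullet> ?U + (R *v ?W) \<bullet> ?W = 2 * ((q - 1) * ((R *v X) \<bullet> X)) + 2 * ((R *v Z) \<bullet> Z)"
    unfolding c(2)[symmetric]
    by (simp add: matrix_vector_right_distrib matrix_vector_mult_diff_distrib inner_add_left
        inner_add_right inner_diff_left inner_diff_right matrix_vector_mult_scaleR algebra_simps)
  have "(q - 2) * (4 * c * ((S *v X) \<bullet> Z)) \<le> (q - 2) * (\<bar>(S *v ?U) \<bullet> ?U\<bar> + \<bar>(S *v ?W) \<bullet> ?W\<bar>)"
    unfolding S'[symmetric] using q by (intro mult_left_mono) auto
  also have "\<dots> \<le> 2 * c * ((R *v ?U) \<bullet> ?U + (R *v ?W) \<bullet> ?W)"
    using ineq[of ?U] ineq[of ?W] by (simp add: c_def distrib_left)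
  finally have "(4 * c) * ((q - 2) * ((S *v X) \<bullet> Z)) \<le> (4 * c) * ((q - 1) * ((R *v X) \<bullet> X) + (R *v Z) \<bullet> Z)"
    unfolding R' by (simp add: algebra_simps)
  then have "(q - 2) * ((S *v X) \<bullet> Z) \<le> (q - 1) * ((R *v X) \<bullet> X) + (R *v Z) \<bullet> Z"
    using c(1) by (simp only: mult_le_cancel_left_pos)
  then show ?thesis by simp
qed

text \<open>A quadratic polynomial \<open>R\<eta>\<cdot>\<eta> + \<beta>\<cdot>\<eta> - \<alpha>\<close> that is nonnegative everywhere has a critical point: the
  component of \<open>\<beta>\<close> orthogonal to the range of \<open>R\<close> lies in the kernel of \<open>R\<close>, so it must vanish.\<close>

lemma nonneg_quadratic_critical_point:
  fixes R :: "real^'n::finite^'n"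
  assumes R: "transpose R = R" and nn: "\<And>\<eta>. 0 \<le> (R *v \<eta>) \<bullet> \<eta> + \<beta> \<bullet> \<eta> - \<alpha>"
  obtains V where "2 *\<^sub>R (R *v V) + \<beta> = 0" "\<alpha> + (R *v V) \<bullet> V \<le> 0"
proof -
  obtain y z where y: "y \<in> span (range ((*v) R))" and z: "\<And>w. w \<in> span (range ((*v) R)) \<Longrightarrow> orthogonal z w"
    and b: "\<beta> = y + z"
    using orthogonal_subspace_decomp_exists[of "range ((*v) R)" \<beta>] by blast
  have sp: "span (range ((*v) R)) = range ((*v) R)"
    by (metis linear_subspace_image matrix_vector_mul_linear span_eq_iff subspace_UNIV)
  obtain x0 where x0: "y = R *v x0"
    using y unfolding sp by blast
  have zo: "z \<bullet> (R *v w) = 0" for w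
    using z[of "R *v w"] unfolding sp by (simp add: orthogonal_def)
  have Rz: "R *v z = 0"
    using symmetric_matrix_inner[OF R, of z "R *v z"] zo by (metis inner_commute inner_eq_zero_iff)
  have zz: "\<beta> \<bullet> z = z \<bullet> z"
    using zo[of x0] inner_commute[of "R *v x0" z] by (simp add: b x0 inner_add_left)
  have "z = 0"
  proof (rule ccontr)
    assume "z \<noteq> 0"
    then have pos: "z \<bullet> z > 0" by simp
    have "0 \<le> t * (z \<bullet> z) - \<alpha>" for t
      using nn[of "t *\<^sub>R z"] Rz zz by (simp add: matrix_vector_mult_scaleR)
    \<comment> \<open>This \<open>t\<close> makes the affine function of \<open>t\<close> equal to
      -1.\<close>
    from this[of "(\<alpha> - 1) / (z \<bullet> z)"] pos show False by simp
  qed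
  define V where "V = (- 1 / 2) *\<^sub>R x0"
  have "2 *\<^sub>R (R *v V) = - \<beta>"
    unfolding V_def matrix_vector_mult_scaleR by (simp add: b x0 \<open>z = 0\<close>)
  then have V: "\<beta> = - (2 *\<^sub>R (R *v V))" by simp
  \<comment> \<open>At the critical point the polynomial takes the value -(\<alpha> + RV.V), so its
    nonnegativity there is the second condition.\<close>
  show ?thesis
    by (rule that[of V]) (use nn[of V] in \<open>simp_all add: V\<close>)
qed

section \<open>C1 bump functions with explicit bounds\<close>

definition bump_base :: "real \<Rightarrow> real^'n::finite \<Rightarrow> real^'n \<Rightarrow> real" where
  "bump_base r c x = max 0 (1 - (x - c) \<bullet> (x - c) / r\<^sup>2)"

text \<open>Squaring removes the kink of the truncated paraboloid on the sphere of radius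
  \<open>r\<close>, so the result is of class C1.\<close>

definition bump :: "real \<Rightarrow> real^'n::finite \<Rightarrow> real^'n \<Rightarrow> real" where
  "bump r c x = (bump_base r c x)\<^sup>2"

definition bump_grad :: "real \<Rightarrow> real^'n::finite \<Rightarrow> real^'n \<Rightarrow> real^'n" where
  "bump_grad r c x = (- 4 * bump_base r c x / r\<^sup>2) *\<^sub>R (x - c)"

lemma DERIV_max_0_power2: "((\<lambda>s. (max 0 s)\<^sup>2) has_real_derivative 2 * max 0 s) (at (s::real))"
proof -
  consider "s > 0" | "s < 0" | "s = 0" by linarith
  then show ?thesis
  proof cases
    case 1
    show ?thesis
      by (rule DERIV_cong[OF has_field_derivative_transform_within_open[of "\<lambda>s. s\<^sup>2" _ _ "{0<..}"]])
        (use 1 in \<open>auto intro!: derivative_eq_intros\<close>)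
  next
    case 2
    show ?thesis
      by (rule DERIV_cong[OF has_field_derivative_transform_within_open[of "\<lambda>s. 0" _ _ "{..<0}"]])
        (use 2 in \<open>auto intro!: derivative_eq_intros\<close>)
  next
    case 3
    have "((\<lambda>h. (max 0 h)\<^sup>2 / h) \<longlongrightarrow> 0) (at (0::real))"
    proof (rule Lim_null_comparison[OF always_eventually])
      show "\<forall>h::real. norm ((max 0 h)\<^sup>2 / h) \<le> \<bar>h\<bar>"
        by (auto simp: max_def power2_eq_square)
      show "((\<lambda>h. \<bar>h\<bar>) \<longlongrightarrow> 0) (at (0::real))"
        using tendsto_rabs[OF tendsto_ident_at[of "0::real" UNIV]] by simp
    qed
    then show ?thesis using 3 by (simp add: has_field_derivative_iff)
  qed
qed

context
  fixes r :: real and c :: "real^'n::finite"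
  assumes r: "r > 0"
begin

lemma bump_base_nonneg [simp]: "0 \<le> bump_base r c x"
  by (simp add: bump_base_def)

lemma bump_base_le_1: "bump_base r c x \<le> 1"
  using r by (simp add: bump_base_def)

lemma bump_base_outside: "x \<notin> cball c r \<Longrightarrow> bump_base r c x = 0"
proof -
  assume "x \<notin> cball c r"
  then have "r\<^sup>2 \<le> (norm (x - c))\<^sup>2"
    using r by (intro power_mono) (auto simp: dist_norm norm_minus_commute)
  then show ?thesis using r by (simp add: bump_base_def power2_norm_eq_inner)
qed

lemma bump_has_derivative: "(bump r c has_derivative (\<lambda>h. bump_grad r c x \<bullet> h)) (at x)"
proof -
  have d: "((\<lambda>x. 1 - (x - c) \<bullet> (x - c) / r\<^sup>2) has_derivative (\<lambda>h. - (2 * ((x - c) \<bullet> h) / r\<^sup>2))) (at x)"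
  proof -
    have "((\<lambda>x. (x - c) \<bullet> (x - c)) has_derivative (\<lambda>h. 2 * ((x - c) \<bullet> h))) (at x)"
      by (auto intro!: derivative_eq_intros simp: inner_commute)
    from has_derivative_diff[OF has_derivative_const has_derivative_scaleR_right[OF this, of "1 / r\<^sup>2"]]
    show ?thesis by simp
  qed
  show ?thesis
    unfolding bump_def[abs_def] bump_base_def bump_grad_def
    by (rule has_derivative_eq_rhs[OF has_derivative_compose[OF d
            has_field_derivative_imp_has_derivative[OF DERIV_max_0_power2]]])
      (simp add: fun_eq_iff)
qed

lemma continuous_bump_base: "continuous_on UNIV (bump_base r c)"
  unfolding bump_base_def[abs_def] by (intro continuous_intros) (use r in auto)

lemma continuous_bump: "continuous_on UNIV (bump r c)"
  unfolding bump_def[abs_def] by (intro continuous_intros continuous_bump_base)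

lemma continuous_bump_grad: "continuous_on UNIV (bump_grad r c)"
  unfolding bump_grad_def[abs_def] by (intro continuous_intros continuous_bump_base) (use r in auto)

lemma bump_nonneg [simp]: "0 \<le> bump r c x"
  by (simp add: bump_def)

lemma bump_le_1: "bump r c x \<le> 1"
  using bump_base_le_1[of x] by (simp add: bump_def power_le_one)

lemma bump_outside: "x \<notin> cball c r \<Longrightarrow> bump r c x = 0"
  by (simp add: bump_def bump_base_outside)

lemma bump_grad_zero: "bump r c x = 0 \<Longrightarrow> bump_grad r c x = 0"
  by (simp add: bump_def bump_grad_def)

text \<open>Inside the ball |x-c| is at most \<open>r\<close>, which cancels one power of
  \<open>r\<close>. This decay makes the gradient terms of a wide bump negligible.\<close>

lemma norm_bump_grad_le: "norm (bump_grad r c x) \<le> 4 / r"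
proof (cases "x \<in> cball c r")
  case True
  have "norm (bump_grad r c x) = 4 * (bump_base r c x * norm (x - c)) / r\<^sup>2"
    by (simp add: bump_grad_def)
  also have "\<dots> \<le> 4 * (1 * r) / r\<^sup>2"
    using True r bump_base_le_1[of x]
    by (intro divide_right_mono mult_left_mono mult_mono) (auto simp: dist_norm norm_minus_commute)
  also have "\<dots> = 4 / r" using r by (simp add: power2_eq_square)
  finally show ?thesis .
next
  case False
  then show ?thesis using bump_grad_zero[OF bump_outside] r by simp
qed

text \<open>Within half the radius the paraboloid is at least 1 - 1/4, and 9/16 is the square of
  3/4. The bound does not depend on \<open>r\<close>.\<close>

lemma bump_ge_on_half_ball: "x \<in> ball c (r / 2) \<Longrightarrow> 9 / 16 \<le> bump r c x"
proof -
  assume "x \<in> ball c (r / 2)"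
  then have "(norm (x - c))\<^sup>2 \<le> (r / 2)\<^sup>2"
    using r by (intro power_mono) (auto simp: dist_norm norm_minus_commute)
  then have "(x - c) \<bullet> (x - c) / r\<^sup>2 \<le> 1 / 4"
    using r by (simp add: power2_norm_eq_inner power_divide pos_divide_le_eq)
  then have "3 / 4 \<le> bump_base r c x" by (simp add: bump_base_def le_max_iff_disj)
  then have "(3 / 4)\<^sup>2 \<le> (bump_base r c x)\<^sup>2" by (intro power_mono) auto
  then show ?thesis by (simp add: bump_def power2_eq_square)
qed

end

text \<open>Only ridge phases \<open>\<Phi>(\<xi>\<cdot>x)\<close> are needed: they keep the gradients of phase and modulus parallel
  to \<open>\<xi>\<close>.\<close>

definition ridge :: "real \<Rightarrow> real^'n::finite \<Rightarrow> (real \<Rightarrow> complex) \<Rightarrow> real^'n \<Rightarrow> real^'n \<Rightarrow> complex" where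
  "ridge r c \<Phi> \<xi> x = complex_of_real (bump r c x) * exp (\<Phi> (\<xi> \<bullet> x))"

context
  fixes r :: real and c :: "real^'n::finite" and \<Phi> \<Phi>' :: "real \<Rightarrow> complex" and \<xi> :: "real^'n"
  assumes r: "r > 0"
    and \<Phi>: "\<And>s. (\<Phi> has_vector_derivative \<Phi>' s) (at s)"
    and \<Phi>': "continuous_on UNIV \<Phi>'"
begin

lemma ridge_has_derivative:
  "(ridge r c \<Phi> \<xi> has_derivative (\<lambda>h. exp (\<Phi> (\<xi> \<bullet> x)) *
     (complex_of_real (bump_grad r c x \<bullet> h) + complex_of_real (bump r c x * (\<xi> \<bullet> h)) * \<Phi>' (\<xi> \<bullet> x)))) (at x)"
proof -
  have 1: "((\<lambda>x. \<Phi> (\<xi> \<bullet> x)) has_derivative (\<lambda>h. (\<xi> \<bullet> h) *\<^sub>R \<Phi>' (\<xi> \<bullet> x))) (at x)"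
    using has_derivative_compose[of "\<lambda>x. \<xi> \<bullet> x" "\<lambda>h. \<xi> \<bullet> h" x UNIV \<Phi>, OF _ \<Phi>[unfolded has_vector_derivative_def]]
      bounded_linear_imp_has_derivative[OF bounded_linear_inner_right[of \<xi>], of "at x"] by simp
  have 2: "((\<lambda>x. exp (\<Phi> (\<xi> \<bullet> x))) has_derivative (\<lambda>h. exp (\<Phi> (\<xi> \<bullet> x)) * ((\<xi> \<bullet> h) *\<^sub>R \<Phi>' (\<xi> \<bullet> x)))) (at x)"
    using has_derivative_compose[OF 1 has_field_derivative_imp_has_derivative[OF DERIV_exp]] .
  show ?thesis
    unfolding ridge_def[abs_def]
    by (rule has_derivative_eq_rhs[OF has_derivative_mult[OF has_derivative_of_real[OF bump_has_derivative[OF r]] 2]])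
      (auto simp: fun_eq_iff scaleR_conv_of_real algebra_simps)
qed

lemma continuous_phase: "continuous_on UNIV (\<lambda>x. \<Phi> (\<xi> \<bullet> x))" "continuous_on UNIV (\<lambda>x. \<Phi>' (\<xi> \<bullet> x))"
proof -
  have "continuous_on UNIV \<Phi>"
    using \<Phi> has_vector_derivative_continuous by (blast intro: continuous_at_imp_continuous_on)
  then show "continuous_on UNIV (\<lambda>x. \<Phi> (\<xi> \<bullet> x))"
    by (rule continuous_on_compose2) (auto intro!: continuous_intros)
  show "continuous_on UNIV (\<lambda>x. \<Phi>' (\<xi> \<bullet> x))"
    by (rule continuous_on_compose2[OF \<Phi>']) (auto intro!: continuous_intros)
qed

lemma ridge_C01:
  assumes "cball c r \<subseteq> \<Omega>"
  shows "ridge r c \<Phi> \<xi> \<in> C01 \<Omega>"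
proof (rule C01_I[OF ridge_has_derivative])
  show "continuous_on UNIV (\<lambda>x. exp (\<Phi> (\<xi> \<bullet> x)) *
     (complex_of_real (bump_grad r c x \<bullet> axis j 1) + complex_of_real (bump r c x * (\<xi> \<bullet> axis j 1)) * \<Phi>' (\<xi> \<bullet> x)))" for j
    by (intro continuous_intros continuous_phase continuous_bump continuous_bump_grad r)
  show "x \<notin> cball c r \<Longrightarrow> ridge r c \<Phi> \<xi> x = 0" for x
    by (simp add: ridge_def bump_outside[OF r])
qed (use assms in auto)

lemma partial_deriv_ridge:
  "partial_deriv j (ridge r c \<Phi> \<xi>) x = exp (\<Phi> (\<xi> \<bullet> x)) *
     (complex_of_real (bump_grad r c x $ j) + complex_of_real (bump r c x * \<xi> $ j) * \<Phi>' (\<xi> \<bullet> x))"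
  using partial_deriv_eq[OF ridge_has_derivative] by (simp add: inner_axis)

lemma cmod_ridge: "cmod (ridge r c \<Phi> \<xi> x) = bump r c x * exp (Re (\<Phi> (\<xi> \<bullet> x)))"
  by (simp add: ridge_def norm_mult bump_nonneg[OF r])

text \<open>Since the bump is positive at \<open>x\<close>, the sign of the ridge is that of its
  exponential, and multiplying by its conjugate turns the exponential into its modulus.\<close>

lemma polar_grad_ridge:
  assumes "bump r c x \<noteq> 0"
  shows "Re_vec (polar_grad (ridge r c \<Phi> \<xi>) x) = exp (Re (\<Phi> (\<xi> \<bullet> x))) *\<^sub>R
      (bump_grad r c x + (bump r c x * Re (\<Phi>' (\<xi> \<bullet> x))) *\<^sub>R \<xi>)"
    and "Im_vec (polar_grad (ridge r c \<Phi> \<xi>) x) = exp (Re (\<Phi> (\<xi> \<bullet> x))) *\<^sub>R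
      ((bump r c x * Im (\<Phi>' (\<xi> \<bullet> x))) *\<^sub>R \<xi>)"
proof -
  let ?e = "exp (\<Phi> (\<xi> \<bullet> x))"
  have pos: "bump r c x > 0" using assms bump_nonneg[OF r, of c x] by linarith
  have "sgn (ridge r c \<Phi> \<xi> x) = sgn ?e"
    using pos by (simp add: ridge_def sgn_mult sgn_of_real)
  moreover have "cnj (sgn ?e) * ?e = complex_of_real (cmod ?e)"
  proof -
    have "cnj (sgn ?e) * ?e = (?e * cnj ?e) / complex_of_real (cmod ?e)"
      by (simp add: sgn_div_norm scaleR_conv_of_real divide_inverse mult_ac del: norm_exp_eq_Re)
    also have "\<dots> = complex_of_real (cmod ?e)"
      unfolding complex_norm_square[symmetric] by (simp add: power2_eq_square del: norm_exp_eq_Re)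
    finally show ?thesis .
  qed
  ultimately have "polar_grad (ridge r c \<Phi> \<xi>) x $ j = complex_of_real (exp (Re (\<Phi> (\<xi> \<bullet> x)))) *
     (complex_of_real (bump_grad r c x $ j) + complex_of_real (bump r c x * \<xi> $ j) * \<Phi>' (\<xi> \<bullet> x))" for j
    by (simp add: polar_grad_def partial_deriv_ridge mult.assoc[symmetric])
  then show "Re_vec (polar_grad (ridge r c \<Phi> \<xi>) x) = exp (Re (\<Phi> (\<xi> \<bullet> x))) *\<^sub>R
      (bump_grad r c x + (bump r c x * Re (\<Phi>' (\<xi> \<bullet> x))) *\<^sub>R \<xi>)"
    "Im_vec (polar_grad (ridge r c \<Phi> \<xi>) x) = exp (Re (\<Phi> (\<xi> \<bullet> x))) *\<^sub>R
      ((bump r c x * Im (\<Phi>' (\<xi> \<bullet> x))) *\<^sub>R \<xi>)"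
    by (simp_all add: vec_eq_iff Re_vec_def Im_vec_def mult_ac)
qed

end

section \<open>The dissipativity criterion\<close>

text \<open>The half ball occupies the fraction 2^(-n) of the volume for every \<open>r\<close>. A
  negative \<open>d\<close> on it can thus be weighed against an error \<open>a\<close> on the full
  ball, uniformly in \<open>r\<close>.\<close>

lemma integral_le_two_balls:
  fixes g :: "real^'n::finite \<Rightarrow> real"
  assumes "integrable lborel g" "r > 0"
    and "\<And>x. g x \<le> a * indicator (cball c r) x + d * indicator (ball c (r / 2)) x"
  shows "integral\<^sup>L lborel g \<le> (a + d / 2 ^ CARD('n)) * measure lborel (cball c r)"
proof -
  have i1: "integrable lborel (\<lambda>x. a * indicator (cball c r) x :: real)"
    by (intro integrable_mult_right integrable_real_indicator) (use emeasure_bounded_finite[OF bounded_cball, of c r] in auto)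
  have i2: "integrable lborel (\<lambda>x. d * indicator (ball c (r / 2)) x :: real)"
    by (intro integrable_mult_right integrable_real_indicator) (use emeasure_bounded_finite[OF bounded_ball, of c "r / 2"] in auto)
  have "integral\<^sup>L lborel g \<le> integral\<^sup>L lborel
      (\<lambda>x. a * indicator (cball c r) x + d * indicator (ball c (r / 2)) x)"
    using assms i1 i2 by (intro integral_mono) auto
  also have "\<dots> = a * measure lborel (cball c r) + d * measure lborel (ball c (r / 2))"
    using i1 i2 by (simp add: Bochner_Integration.integral_add)
  also have "measure lborel (ball c (r / 2)) = measure lborel (cball c r) / 2 ^ CARD('n)"
    using assms(2) content_ball_conv_unit_ball[of "r / 2" c] content_ball_conv_unit_ball[of r c]
    by (simp add: content_cball_conv_ball power_divide)
  finally show ?thesis by (simp add: algebra_simps)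
qed

text \<open>Common frame for both ranges of p: \<open>S\<close> and \<open>B\<close> absorb what
  differs between the two orders of arguments, and \<open>I u\<close> is the real part of the
  integrand. The density formula is confined to \<open>u x \<noteq> 0\<close>; at zeros, necessity
  relies on \<open>I_critical_zero\<close> and sufficiency on \<open>I_zero_nonneg\<close>.\<close>

locale radial_form =
  fixes \<Omega> :: "(real^'n::finite) set" and q :: real and R S :: "real^'n^'n"
    and B \<beta> :: "real^'n" and \<alpha> :: real
    and I :: "(real^'n \<Rightarrow> complex) \<Rightarrow> real^'n \<Rightarrow> real"
  assumes q: "q \<ge> 2" and R_sym: "transpose R = R" and S_sym: "transpose S = S"
    and I_integrable: "u \<in> C01 \<Omega> \<Longrightarrow> integrable lborel (I u)"
    and I_eq: "u \<in> C01 \<Omega> \<Longrightarrow> u x \<noteq> 0 \<Longrightarrow> I u x = radial_density q R S B \<beta> \<alpha> (cmod (u x))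
      (Re_vec (polar_grad u x)) (Im_vec (polar_grad u x))"
    and I_critical_zero: "u \<in> C01 \<Omega> \<Longrightarrow> u x = 0 \<Longrightarrow> (\<And>j. partial_deriv j u x = 0) \<Longrightarrow> I u x = 0"
    and I_zero_nonneg: "u \<in> C01 \<Omega> \<Longrightarrow> u x = 0 \<Longrightarrow> (\<And>\<xi>. (R *v \<xi>) \<bullet> \<xi> \<ge> 0) \<Longrightarrow> I u x \<ge> 0"
begin

text \<open>Completing the square with \<open>Z = Y - \<rho> V\<close> leaves only multiples of \<open>\<rho>\<^bsup>q-1\<^esup> X = \<nabla>(\<rho>\<^sup>q)/q\<close>, which
  integrate to zero.\<close>

lemma integral_nonneg:
  assumes V: "2 *\<^sub>R (R *v V) + \<beta> = 0" "\<alpha> + (R *v V) \<bullet> V \<le> 0"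
    and ineq: "\<And>\<xi>. (q - 2) * \<bar>(S *v \<xi>) \<bullet> \<xi>\<bar> \<le> 2 * sqrt (q - 1) * ((R *v \<xi>) \<bullet> \<xi>)"
    and u: "u \<in> C01 \<Omega>"
  shows "0 \<le> integral\<^sup>L lborel (I u)"
proof -
  have R_nonneg: "(R *v \<xi>) \<bullet> \<xi> \<ge> 0" for \<xi>
  proof -
    have "0 \<le> (q - 2) * \<bar>(S *v \<xi>) \<bullet> \<xi>\<bar>" using q by simp
    with ineq[of \<xi>] have "0 \<le> 2 * sqrt (q - 1) * ((R *v \<xi>) \<bullet> \<xi>)" by linarith
    then show ?thesis using q by (simp add: zero_le_mult_iff)
  qed
  \<comment> \<open>Coefficient of the remaining terms linear in X: \<open>B\<close> from the first
    order part, the rest from inserting Y = Z + \<rho>V into the cross term.\<close>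
  define K where "K = B + (q - 2) *\<^sub>R (S *v V)"
  define D where "D j x = Re (partial_deriv j (\<lambda>x. duality_map q u x * cnj (u x)) x)" for j x
  have uu: "(\<lambda>x. duality_map q u x * cnj (u x)) \<in> C01 \<Omega>"
    by (rule C01_mult_cnj(1)[OF C01_duality_map[OF q u] u])
  have D_int: "integrable lborel (D j)" "integral\<^sup>L lborel (D j) = 0" for j
    using C01_integrable_partial_deriv[OF uu, of j] integral_partial_deriv_eq_0[OF uu, of j]
    by (simp_all add: D_def[abs_def])
  have D: "D j x = q * (cmod (u x) powr (q - 2) * cmod (u x) * Re_vec (polar_grad u x) $ j)" for j x
    unfolding D_def by (rule Re_partial_deriv_duality_map_mult_cnj[OF q u])
  have le: "(\<Sum>j\<in>UNIV. - (K $ j / q) * D j x) \<le> I u x" for x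
  proof -
    let ?\<rho> = "cmod (u x)" and ?X = "Re_vec (polar_grad u x)" and ?Y = "Im_vec (polar_grad u x)"
    have sum: "(\<Sum>j\<in>UNIV. - (K $ j / q) * D j x) = - (?\<rho> powr (q - 2) * ?\<rho> * (K \<bullet> ?X))"
      using q by (simp add: D inner_vec_def sum_distrib_left sum_negf mult_ac)
    show ?thesis
    proof (cases "u x = 0")
      case True
      then show ?thesis using I_zero_nonneg[OF u True R_nonneg] by (simp add: D)
    next
      case False
      define Z where "Z = ?Y - ?\<rho> *\<^sub>R V"
      have Y: "?Y = Z + ?\<rho> *\<^sub>R V" by (simp add: Z_def)
      have b: "\<beta> = - (2 *\<^sub>R (R *v V))" using V(1) by (simp add: eq_neg_iff_add_eq_0 add.commute)
      have RV: "(R *v V) \<bullet> Z = (R *v Z) \<bullet> V" by (rule symmetric_matrix_inner[OF R_sym])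
      have SV: "(S *v V) \<bullet> ?X = (S *v ?X) \<bullet> V" by (rule symmetric_matrix_inner[OF S_sym])
      \<comment> \<open>The terms linear in Z cancel because \<beta> = -2RV.\<close>
      have "(q - 1) * ((R *v ?X) \<bullet> ?X) + (R *v ?Y) \<bullet> ?Y - (q - 2) * ((S *v ?X) \<bullet> ?Y)
         + ?\<rho> * (\<beta> \<bullet> ?Y) - ?\<rho> * (B \<bullet> ?X) - \<alpha> * ?\<rho>\<^sup>2
         = ((q - 1) * ((R *v ?X) \<bullet> ?X) + (R *v Z) \<bullet> Z - (q - 2) * ((S *v ?X) \<bullet> Z))
          + (- (\<alpha> + (R *v V) \<bullet> V)) * ?\<rho>\<^sup>2 - ?\<rho> * (K \<bullet> ?X)"
        unfolding Y b K_def
        by (simp add: matrix_vector_right_distrib inner_add_left inner_add_right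
            matrix_vector_mult_scaleR RV SV algebra_simps power2_eq_square)
      moreover have "0 \<le> (- (\<alpha> + (R *v V) \<bullet> V)) * ?\<rho>\<^sup>2"
        using V(2) by (intro mult_nonneg_nonneg) auto
      ultimately have "- (?\<rho> * (K \<bullet> ?X)) \<le> (q - 1) * ((R *v ?X) \<bullet> ?X) + (R *v ?Y) \<bullet> ?Y - (q - 2) * ((S *v ?X) \<bullet> ?Y)
         + ?\<rho> * (\<beta> \<bullet> ?Y) - ?\<rho> * (B \<bullet> ?X) - \<alpha> * ?\<rho>\<^sup>2"
        using quadratic_form_nonneg[OF q R_sym S_sym ineq, of ?X Z] by linarith
      then have "?\<rho> powr (q - 2) * - (?\<rho> * (K \<bullet> ?X)) \<le> I u x"
        unfolding I_eq[OF u False] radial_density_def by (intro mult_left_mono) auto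
      then show ?thesis unfolding sum by (simp add: mult_ac)
    qed
  qed
  have "0 = integral\<^sup>L lborel (\<lambda>x. \<Sum>j\<in>UNIV. - (K $ j / q) * D j x)"
    using D_int by (subst Bochner_Integration.integral_sum) auto
  also have "\<dots> \<le> integral\<^sup>L lborel (I u)"
    using le D_int I_integrable[OF u] by (intro integral_mono) auto
  finally show ?thesis .
qed

section \<open>Necessity: ridge test functions and the low frequency condition\<close>

definition ridge_energy :: "real \<Rightarrow> real^'n \<Rightarrow> real^'n \<Rightarrow> real \<Rightarrow> real \<Rightarrow> real^'n \<Rightarrow> real" where
  "ridge_energy r c \<xi> \<kappa> l x = bump r c x powr (q - 2) *
     ((q - 1) * ((R *v bump_grad r c x) \<bullet> bump_grad r c x)
      + bump r c x * (2 * (q - 1) * \<kappa> * ((R *v bump_grad r c x) \<bullet> \<xi>)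
           - (q - 2) * l * ((S *v bump_grad r c x) \<bullet> \<xi>) - B \<bullet> bump_grad r c x)
      + (bump r c x)\<^sup>2 * (((q - 1) * \<kappa>\<^sup>2 + l\<^sup>2) * ((R *v \<xi>) \<bullet> \<xi>) - (q - 2) * \<kappa> * l * ((S *v \<xi>) \<bullet> \<xi>)
           + l * (\<beta> \<bullet> \<xi>) - \<kappa> * (B \<bullet> \<xi>) - \<alpha>))"

text \<open>The density is homogeneous of degree q in (\<rho>, X, Y), so the common factor exp(Re
  \<Phi>) comes out with exponent q. What remains is \<open>ridge_energy\<close>, where \<kappa> and
  l are the two parts of \<Phi>' and the terms are sorted by explicit powers of the bump and its
  gradient.\<close>

lemma I_ridge:
  assumes r: "r > 0" and \<Phi>: "\<And>s. (\<Phi> has_vector_derivative \<Phi>' s) (at s)"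
    and \<Phi>': "continuous_on UNIV \<Phi>'" and sub: "cball c r \<subseteq> \<Omega>"
  shows "I (ridge r c \<Phi> \<xi>) x = exp (q * Re (\<Phi> (\<xi> \<bullet> x))) *
    ridge_energy r c \<xi> (Re (\<Phi>' (\<xi> \<bullet> x))) (Im (\<Phi>' (\<xi> \<bullet> x))) x"
proof (cases "bump r c x = 0")
  case True
  have "I (ridge r c \<Phi> \<xi>) x = 0"
    by (rule I_critical_zero[OF ridge_C01[OF r \<Phi> \<Phi>' sub]])
      (simp_all add: ridge_def True partial_deriv_ridge[OF r \<Phi> \<Phi>'] bump_grad_zero[OF r])
  then show ?thesis using True by (simp add: ridge_energy_def)
next
  case False
  define E where "E = exp (Re (\<Phi> (\<xi> \<bullet> x)))"
  define f where "f = bump r c x"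
  define G where "G = bump_grad r c x"
  define k where "k = Re (\<Phi>' (\<xi> \<bullet> x))"
  define l where "l = Im (\<Phi>' (\<xi> \<bullet> x))"
  have f: "f > 0" using False bump_nonneg[OF r, of c x] by (simp add: f_def)
  have E: "E > 0" by (simp add: E_def)
  have Eq: "exp (q * Re (\<Phi> (\<xi> \<bullet> x))) = E powr (q - 2) * E\<^sup>2"
    unfolding E_def power2_eq_square
    by (simp add: powr_def mult_exp_exp algebra_simps)
  have ne: "ridge r c \<Phi> \<xi> x \<noteq> 0" using False by (simp add: ridge_def)
  have Sx: "(S *v \<xi>) \<bullet> G = (S *v G) \<bullet> \<xi>" and Rx: "(R *v \<xi>) \<bullet> G = (R *v G) \<bullet> \<xi>"
    by (rule symmetric_matrix_inner[OF S_sym], rule symmetric_matrix_inner[OF R_sym])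
  have "I (ridge r c \<Phi> \<xi>) x = radial_density q R S B \<beta> \<alpha> (f * E)
      (E *\<^sub>R (G + (f * k) *\<^sub>R \<xi>)) (E *\<^sub>R ((f * l) *\<^sub>R \<xi>))"
    unfolding I_eq[where u = "ridge r c \<Phi> \<xi>" and x = x, OF ridge_C01[OF r \<Phi> \<Phi>' sub] ne] cmod_ridge[OF r \<Phi> \<Phi>']
      polar_grad_ridge[OF r \<Phi> \<Phi>' False] E_def f_def G_def k_def l_def ..
  also have "\<dots> = (E powr (q - 2) * E\<^sup>2) * ridge_energy r c \<xi> k l x"
    unfolding radial_density_def ridge_energy_def f_def[symmetric] G_def[symmetric]
    using E f
    by (simp add: powr_mult matrix_vector_right_distrib inner_add_left inner_add_right
            matrix_vector_mult_scaleR Sx Rx algebra_simps power2_eq_square)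
  finally show ?thesis unfolding Eq k_def l_def .
qed

text \<open>Collects the terms with \<kappa> = 0 that contain a gradient of the bump. Each has at
  least one factor of size 4/r, and for \<open>r \<ge> 1\<close> the quadratic one is of order 1/r
  as well.\<close>

lemma ridge_energy_bound:
  obtains C where "C \<ge> 0" "\<And>r (c::real^'n) x. r \<ge> 1 \<Longrightarrow> bump r c x powr (q - 2) *
     ((q - 1) * ((R *v bump_grad r c x) \<bullet> bump_grad r c x)
      + bump r c x * (- (q - 2) * l * ((S *v bump_grad r c x) \<bullet> \<xi>) - B \<bullet> bump_grad r c x))
     \<le> C / r * indicator (cball c r) x"
proof -
  obtain KR where KR: "\<And>x. norm (R *v x) \<le> norm x * KR" "KR \<ge> 0"
    using bounded_linear.nonneg_bounded[OF matrix_vector_mul_bounded_linear[of R]] by blast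
  obtain KS where KS: "\<And>x. norm (S *v x) \<le> norm x * KS" "KS \<ge> 0"
    using bounded_linear.nonneg_bounded[OF matrix_vector_mul_bounded_linear[of S]] by blast
  define C where "C = (q - 1) * KR * 16 + (q - 2) * \<bar>l\<bar> * KS * norm \<xi> * 4 + norm B * 4"
  have C: "C \<ge> 0" unfolding C_def using q KR(2) KS(2) by (intro add_nonneg_nonneg mult_nonneg_nonneg) auto
  show ?thesis
  proof (rule that[OF C])
    fix r :: real and c x :: "real^'n" assume r1: "r \<ge> 1"
    then have r: "r > 0" by simp
    let ?G = "bump_grad r c x" and ?f = "bump r c x"
    show "?f powr (q - 2) * ((q - 1) * ((R *v ?G) \<bullet> ?G)
      + ?f * (- (q - 2) * l * ((S *v ?G) \<bullet> \<xi>) - B \<bullet> ?G)) \<le> C / r * indicator (cball c r) x"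
    proof (cases "x \<in> cball c r")
      case False
      then show ?thesis using bump_outside[OF r False] by simp
    next
      case True
      have G: "norm ?G \<le> 4 / r" by (rule norm_bump_grad_le[OF r])
      have G16: "norm ?G * norm ?G \<le> 16 / r"
      proof -
        have "norm ?G * norm ?G \<le> (4 / r) * (4 / r)" using G r by (intro mult_mono) auto
        also have "\<dots> = 16 / r * (1 / r)" by simp
        also have "\<dots> \<le> 16 / r * 1" using r1 by (intro mult_left_mono) auto
        finally show ?thesis by simp
      qed
      have "(R *v ?G) \<bullet> ?G \<le> norm (R *v ?G) * norm ?G" by (rule norm_cauchy_schwarz)
      also have "\<dots> \<le> (norm ?G * KR) * norm ?G" by (intro mult_right_mono KR) auto
      also have "\<dots> = KR * (norm ?G * norm ?G)" by simp
      also have "\<dots> \<le> KR * (16 / r)" by (intro mult_left_mono G16 KR)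
      finally have 1: "(q - 1) * ((R *v ?G) \<bullet> ?G) \<le> (q - 1) * (KR * (16 / r))"
        using q by (intro mult_left_mono) auto
      have "\<bar>(S *v ?G) \<bullet> \<xi>\<bar> \<le> norm (S *v ?G) * norm \<xi>" by (rule Cauchy_Schwarz_ineq2)
      also have "\<dots> \<le> (norm ?G * KS) * norm \<xi>" by (intro mult_right_mono KS) auto
      also have "\<dots> \<le> (4 / r * KS) * norm \<xi>" by (intro mult_right_mono G KS) auto
      finally have "(q - 2) * \<bar>l\<bar> * \<bar>(S *v ?G) \<bullet> \<xi>\<bar> \<le> (q - 2) * \<bar>l\<bar> * ((4 / r * KS) * norm \<xi>)"
        using q by (intro mult_left_mono) auto
      moreover have "- (q - 2) * l * ((S *v ?G) \<bullet> \<xi>) \<le> \<bar>- (q - 2) * l * ((S *v ?G) \<bullet> \<xi>)\<bar>"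
        by (rule abs_ge_self)
      moreover have "\<bar>- (q - 2) * l * ((S *v ?G) \<bullet> \<xi>)\<bar> = (q - 2) * \<bar>l\<bar> * \<bar>(S *v ?G) \<bullet> \<xi>\<bar>"
        using q by (simp add: abs_mult)
      moreover have "\<bar>B \<bullet> ?G\<bar> \<le> norm B * (4 / r)"
        using Cauchy_Schwarz_ineq2[of B ?G] mult_left_mono[OF G, of "norm B"] by simp
      ultimately have "- (q - 2) * l * ((S *v ?G) \<bullet> \<xi>) - B \<bullet> ?G
         \<le> (q - 2) * \<bar>l\<bar> * ((4 / r * KS) * norm \<xi>) + norm B * (4 / r)" (is "?a \<le> ?b")
        by linarith
      moreover have b0: "0 \<le> ?b" using q r KS(2)
        by (intro add_nonneg_nonneg mult_nonneg_nonneg) auto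
      ultimately have "?f * ?a \<le> ?f * ?b"
        using bump_nonneg[OF r, of c x] by (intro mult_left_mono)
      also have "?f * ?b \<le> 1 * ?b"
        by (rule mult_right_mono[OF bump_le_1[OF r] b0])
      finally have "?f * ?a \<le> 1 * ?b" .
      with 1 have "(q - 1) * ((R *v ?G) \<bullet> ?G) + ?f * ?a \<le> (q - 1) * (KR * (16 / r)) + ?b" (is "?L \<le> _")
        by simp
      also have "\<dots> = C / r" using r by (simp add: C_def field_simps)
      finally have L: "?L \<le> C / r" .
      have p: "0 \<le> ?f powr (q - 2)" "?f powr (q - 2) \<le> 1"
        using powr_le1[of "q - 2" ?f] bump_nonneg[OF r, of c x] bump_le_1[OF r, of c x] q by auto
      have "?f powr (q - 2) * ?L \<le> ?f powr (q - 2) * (C / r)" by (rule mult_left_mono[OF L p(1)])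
      also have "\<dots> \<le> 1 * (C / r)" using p C r by (intro mult_right_mono) auto
      finally show ?thesis using True by simp
    qed
  qed
qed

text \<open>The powers of the bump combine to exponent q. As \<open>G \<le> 0\<close>, the lower
  bound on the half ball becomes an upper bound after multiplication, and the contribution elsewhere
  is at most 0.\<close>

lemma bump_powr_ge_on_half_ball:
  assumes "r > 0" "G \<le> 0"
  shows "bump r c x powr (q - 2) * (bump r c x)\<^sup>2 * G \<le> (9 / 16) powr q * G * indicator (ball c (r / 2)) x"
proof (cases "x \<in> ball c (r / 2)")
  case True
  have f: "9 / 16 \<le> bump r c x" by (rule bump_ge_on_half_ball[OF assms(1) True])
  have "bump r c x powr (q - 2) * (bump r c x)\<^sup>2 = bump r c x powr q"
    using f powr_add[of "bump r c x" "q - 2" 2] by simp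
  moreover have "(9 / 16) powr q \<le> bump r c x powr q"
    using f q by (intro powr_mono2) auto
  ultimately show ?thesis using True assms(2) by (simp add: mult_right_mono_neg)
next
  case False
  then show ?thesis using assms(2) by (simp add: mult_nonneg_nonpos)
qed

text \<open>A negative value of the polynomial costs a fixed fraction of the volume of the ball,
  whereas the gradient errors are O(1/r) times that volume; a large ball gives a
  contradiction.\<close>

lemma low_frequency_condition:
  assumes diss: "\<And>u. u \<in> C01 \<Omega> \<Longrightarrow> 0 \<le> integral\<^sup>L lborel (I u)"
    and balls: "\<And>r. \<exists>c. cball c r \<subseteq> \<Omega>"
  shows "0 \<le> (R *v \<eta>) \<bullet> \<eta> + \<beta> \<bullet> \<eta> - \<alpha>" (is "0 \<le> ?G")
proof (rule ccontr)
  assume "\<not> 0 \<le> ?G"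
  then have neg: "?G < 0" by simp
  obtain C where C: "C \<ge> 0" "\<And>r (c::real^'n) x. r \<ge> 1 \<Longrightarrow> bump r c x powr (q - 2) *
     ((q - 1) * ((R *v bump_grad r c x) \<bullet> bump_grad r c x)
      + bump r c x * (- (q - 2) * 1 * ((S *v bump_grad r c x) \<bullet> \<eta>) - B \<bullet> bump_grad r c x))
     \<le> C / r * indicator (cball c r) x"
    using ridge_energy_bound[of 1 \<eta>] by blast
  \<comment> \<open>The loss per unit volume of the full ball: the bound on the half ball times its
    volume fraction.\<close>
  define d where "d = (9 / 16) powr q * (- ?G) / 2 ^ CARD('n)"
  have d: "d > 0" unfolding d_def using neg by (intro divide_pos_pos mult_pos_pos) auto
  \<comment> \<open>At least 1 for the gradient estimate, and beyond 2C/d so that the error C/r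
    falls below the loss d.\<close>
  define r where "r = max 1 (2 * C / d + 1)"
  have r1: "r \<ge> 1" and r0: "r > 0" and rC: "2 * C / d < r" by (auto simp: r_def)
  obtain c where c: "cball c r \<subseteq> \<Omega>" using balls by blast
  let ?\<Phi> = "\<lambda>s. complex_of_real s * \<i>"
  have \<Phi>: "(?\<Phi> has_vector_derivative \<i>) (at s)" for s
    by (auto intro!: derivative_eq_intros simp: has_vector_derivative_def scaleR_conv_of_real)
  let ?u = "ridge r c ?\<Phi> \<eta>"
  have u: "?u \<in> C01 \<Omega>" by (rule ridge_C01[OF r0 \<Phi> _ c]) auto
  have "I ?u x \<le> C / r * indicator (cball c r) x + ((9 / 16) powr q * ?G) * indicator (ball c (r / 2)) x" for x
  proof -
    have "I ?u x = ridge_energy r c \<eta> 0 1 x"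
      using I_ridge[OF r0 \<Phi> _ c, of \<eta> x] by simp
    also have "\<dots> = bump r c x powr (q - 2) *
     ((q - 1) * ((R *v bump_grad r c x) \<bullet> bump_grad r c x)
      + bump r c x * (- (q - 2) * 1 * ((S *v bump_grad r c x) \<bullet> \<eta>) - B \<bullet> bump_grad r c x))
      + bump r c x powr (q - 2) * (bump r c x)\<^sup>2 * ?G"
      by (simp add: ridge_energy_def algebra_simps)
    also have "\<dots> \<le> C / r * indicator (cball c r) x + (9 / 16) powr q * ?G * indicator (ball c (r / 2)) x"
      by (rule add_mono[OF C(2)[OF r1] bump_powr_ge_on_half_ball[OF r0]]) (use neg in simp)
    finally show ?thesis .
  qed
  from integral_le_two_balls[OF I_integrable[OF u] r0 this]
  have "integral\<^sup>L lborel (I ?u) \<le> (C / r - d) * measure lborel (cball c r)"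
    unfolding d_def by (simp only: mult_minus_right minus_divide_left[symmetric] diff_minus_eq_add)
  with diss[OF u] have "0 \<le> (C / r - d) * measure lborel (cball c r)" by linarith
  moreover have "measure lborel (cball c r) > 0" by (rule content_cball_pos[OF r0])
  ultimately have "d \<le> C / r" by (simp add: zero_le_mult_iff)
  moreover have "C / r < d"
  proof -
    have "2 * C < r * d" using rC d by (simp add: pos_divide_less_eq)
    then have "C < r * d" using C(1) by linarith
    then show ?thesis using r0 by (simp add: pos_divide_less_eq mult.commute)
  qed
  ultimately show False by simp
qed

end

section \<open>Necessity: oscillating moduli and the high frequency condition\<close>

context radial_form
begin

text \<open>\<open>\<Phi> = (1 + i\<mu>) (2/q) ln (2 + cos)\<close> makes the phase gradient \<open>\<mu>\<close> times the logarithmic gradient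
  of the modulus. Since \<open>e\<^bsup>q Re \<Phi>\<^esup> = (2 + cos)\<^sup>2\<close>, summing over the four quarter-period shifts cancels all
  terms that are odd in \<open>\<xi>\<close> pointwise.\<close>

definition log_phase :: "real \<Rightarrow> real \<Rightarrow> real \<Rightarrow> complex" where
  "log_phase \<mu> \<delta> s = (2 / q * ln (2 + cos (s + \<delta>))) *\<^sub>R Complex 1 \<mu>"

definition log_phase_deriv :: "real \<Rightarrow> real \<Rightarrow> real \<Rightarrow> complex" where
  "log_phase_deriv \<mu> \<delta> s = (- (2 / q * (sin (s + \<delta>) / (2 + cos (s + \<delta>))))) *\<^sub>R Complex 1 \<mu>"

lemma two_plus_cos_pos: "2 + cos t > (0::real)"
  using cos_ge_minus_one[of t] by linarith

lemma log_phase_has_derivative: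
  "(log_phase \<mu> \<delta> has_vector_derivative log_phase_deriv \<mu> \<delta> s) (at s)"
proof -
  have "((\<lambda>s. 2 / q * ln (2 + cos (s + \<delta>))) has_real_derivative
     - (2 / q * (sin (s + \<delta>) / (2 + cos (s + \<delta>))))) (at s)"
    using two_plus_cos_pos[of "s + \<delta>"] q by (auto intro!: derivative_eq_intros simp: mult.commute)
  then show ?thesis
    unfolding log_phase_def[abs_def] log_phase_deriv_def
    by (rule has_vector_derivative_scaleR[OF _ has_vector_derivative_const, THEN has_vector_derivative_eq_rhs]) simp
qed

lemma continuous_log_phase_deriv: "continuous_on UNIV (log_phase_deriv \<mu> \<delta>)"
  unfolding log_phase_deriv_def[abs_def]
  using two_plus_cos_pos by (intro continuous_intros) (auto simp: less_imp_neq[THEN not_sym])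

text \<open>Expansion in powers of the logarithmic slope k of the modulus, with phase slope \<mu>k.
  Only the middle term is odd in \<xi> apart from its trigonometric factor.\<close>

lemma I_log_ridge:
  assumes r: "r > 0" and sub: "cball c r \<subseteq> \<Omega>"
  shows "I (ridge r c (log_phase \<mu> \<delta>) \<xi>) x =
    (2 + cos (\<xi> \<bullet> x + \<delta>))\<^sup>2 * ridge_energy r c \<xi> 0 0 x
    + (- (2 / q) * (sin (\<xi> \<bullet> x + \<delta>) * (2 + cos (\<xi> \<bullet> x + \<delta>)))) * (bump r c x powr (q - 2) *
     (bump r c x * (2 * (q - 1) * ((R *v bump_grad r c x) \<bullet> \<xi>)
           - (q - 2) * \<mu> * ((S *v bump_grad r c x) \<bullet> \<xi>))
      + (bump r c x)\<^sup>2 * (\<mu> * (\<beta> \<bullet> \<xi>) - (B \<bullet> \<xi>))))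
    + (4 / q\<^sup>2 * (sin (\<xi> \<bullet> x + \<delta>))\<^sup>2) * (bump r c x powr (q - 2) *
      (bump r c x)\<^sup>2 * ((q - 1 + \<mu>\<^sup>2) * ((R *v \<xi>) \<bullet> \<xi>) - (q - 2) * \<mu> * ((S *v \<xi>) \<bullet> \<xi>)))"
proof -
  define g where "g = 2 + cos (\<xi> \<bullet> x + \<delta>)"
  define d where "d = sin (\<xi> \<bullet> x + \<delta>)"
  define k where "k = - (2 / q * (d / g))"
  have g: "g > 0" unfolding g_def by (rule two_plus_cos_pos)
  have E: "exp (q * Re (log_phase \<mu> \<delta> (\<xi> \<bullet> x))) = g\<^sup>2"
  proof -
    have "q * Re (log_phase \<mu> \<delta> (\<xi> \<bullet> x)) = ln g + ln g"
      using q by (simp add: log_phase_def g_def)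
    then show ?thesis using g by (simp only: exp_add exp_ln power2_eq_square)
  qed
  \<comment> \<open>The weight g^2 clears the denominators of k and k^2, leaving trigonometric
    polynomials to be averaged.\<close>
  have k1: "g\<^sup>2 * k = - (2 / q) * (d * g)" and k2: "g\<^sup>2 * k\<^sup>2 = 4 / q\<^sup>2 * d\<^sup>2"
    using g by (simp_all add: k_def power2_eq_square)
  have "I (ridge r c (log_phase \<mu> \<delta>) \<xi>) x = g\<^sup>2 * ridge_energy r c \<xi> k (k * \<mu>) x"
    unfolding I_ridge[OF r log_phase_has_derivative continuous_log_phase_deriv sub] E
    by (simp add: log_phase_deriv_def k_def d_def g_def)
  also have "\<dots> = g\<^sup>2 * ridge_energy r c \<xi> 0 0 x
    + (g\<^sup>2 * k) * (bump r c x powr (q - 2) *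
     (bump r c x * (2 * (q - 1) * ((R *v bump_grad r c x) \<bullet> \<xi>)
           - (q - 2) * \<mu> * ((S *v bump_grad r c x) \<bullet> \<xi>))
      + (bump r c x)\<^sup>2 * (\<mu> * (\<beta> \<bullet> \<xi>) - (B \<bullet> \<xi>))))
    + (g\<^sup>2 * k\<^sup>2) * (bump r c x powr (q - 2) *
      (bump r c x)\<^sup>2 * ((q - 1 + \<mu>\<^sup>2) * ((R *v \<xi>) \<bullet> \<xi>) - (q - 2) * \<mu> * ((S *v \<xi>) \<bullet> \<xi>)))"
    unfolding ridge_energy_def by (simp add: algebra_simps power2_eq_square)
  finally show ?thesis unfolding k1 k2 unfolding g_def d_def .
qed

text \<open>The shifts run through the four rotations of (cos s, sin s) by right angles. The sums of
  sin and of sin cos vanish, that of sin^2 is 2, and that of (2 + cos)^2 is 16 + 2. Exact averaging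
  replaces a limit of oscillatory integrals.\<close>

lemma quarter_shift_sum:
  fixes K1 K2 K3 s :: real
  assumes "\<And>\<delta>. F \<delta> = (2 + cos (s + \<delta>))\<^sup>2 * K1
    + (- (2 / q) * (sin (s + \<delta>) * (2 + cos (s + \<delta>)))) * K2 + (4 / q\<^sup>2 * (sin (s + \<delta>))\<^sup>2) * K3"
  shows "F 0 + F (pi / 2) + F pi + F (- (pi / 2)) = 18 * K1 + 8 / q\<^sup>2 * K3"
proof -
  define a where "a = cos s"
  define b where "b = sin s"
  have ab: "a * a + b * b = 1"
    using sin_cos_squared_add[of s] by (simp add: a_def b_def power2_eq_square)
  have trig: "cos (s + 0) = a" "sin (s + 0) = b" "cos (s + pi / 2) = - b" "sin (s + pi / 2) = a"
    "cos (s + pi) = - a" "sin (s + pi) = - b" "cos (s + - (pi / 2)) = b" "sin (s + - (pi / 2)) = - a"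
    unfolding cos_add sin_add a_def b_def by simp_all
  define m where "m = 2 / q"
  define n where "n = 4 / q\<^sup>2"
  have n8: "8 / q\<^sup>2 = 2 * n" by (simp add: n_def)
  have "F 0 + F (pi / 2) + F pi + F (- (pi / 2)) =
     (16 + 2 * (a * a + b * b)) * K1 + 2 * (a * a + b * b) * n * K3"
    unfolding assms trig m_def[symmetric] n_def[symmetric] by (simp add: power2_eq_square algebra_simps)
  then show ?thesis unfolding ab n8 by simp
qed

text \<open>On a fixed ball, scaling \<xi> by \<open>t\<close> multiplies the averaged quadratic
  term by t^2 and leaves the other averaged term bounded. A negative \<open>?Q\<close> would
  therefore make the total negative for large \<open>t\<close>.\<close>

lemma high_frequency_condition:
  assumes diss: "\<And>u. u \<in> C01 \<Omega> \<Longrightarrow> 0 \<le> integral\<^sup>L lborel (I u)"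
    and sub: "cball c 1 \<subseteq> \<Omega>"
  shows "0 \<le> (q - 1 + \<mu>\<^sup>2) * ((R *v \<xi>) \<bullet> \<xi>) - (q - 2) * \<mu> * ((S *v \<xi>) \<bullet> \<xi>)" (is "0 \<le> ?Q")
proof (rule ccontr)
  assume "\<not> 0 \<le> ?Q"
  then have neg: "?Q < 0" by simp
  obtain C where C: "C \<ge> 0" "\<And>r (c::real^'n) x. r \<ge> 1 \<Longrightarrow> bump r c x powr (q - 2) *
     ((q - 1) * ((R *v bump_grad r c x) \<bullet> bump_grad r c x)
      + bump r c x * (- (q - 2) * 0 * ((S *v bump_grad r c x) \<bullet> \<xi>) - B \<bullet> bump_grad r c x))
     \<le> C / r * indicator (cball c r) x"
    using ridge_energy_bound[of 0 \<xi>] by blast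
  have r: "(1::real) > 0" by simp
  \<comment> \<open>With both slopes zero the energy does not depend on the direction, so the bound
    is uniform in \<eta> and survives the scaling.\<close>
  have K: "ridge_energy 1 c \<eta> 0 0 x \<le> (C + \<bar>\<alpha>\<bar>) * indicator (cball c 1) x" for \<eta> x
  proof -
    let ?f = "bump 1 c x" and ?G = "bump_grad 1 c x"
    have "ridge_energy 1 c \<eta> 0 0 x = ?f powr (q - 2) *
     ((q - 1) * ((R *v ?G) \<bullet> ?G) + ?f * (- (q - 2) * 0 * ((S *v ?G) \<bullet> \<xi>) - B \<bullet> ?G))
     + (?f powr (q - 2) * ?f\<^sup>2) * (- \<alpha>)"
      by (simp add: ridge_energy_def algebra_simps)
    also have "(?f powr (q - 2) * ?f\<^sup>2) * (- \<alpha>) \<le> \<bar>\<alpha>\<bar> * indicator (cball c 1) x"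
    proof (cases "x \<in> cball c 1")
      case True
      have "?f powr (q - 2) * ?f\<^sup>2 \<le> 1 * 1"
        using powr_le1[of "q - 2" ?f] bump_nonneg[OF r, of c x] bump_le_1[OF r, of c x] q
        by (intro mult_mono) (auto simp: power_le_one)
      moreover have "0 \<le> ?f powr (q - 2) * ?f\<^sup>2" by simp
      ultimately have "(?f powr (q - 2) * ?f\<^sup>2) * \<bar>\<alpha>\<bar> \<le> 1 * \<bar>\<alpha>\<bar>"
        by (intro mult_right_mono) auto
      moreover have "(?f powr (q - 2) * ?f\<^sup>2) * (- \<alpha>) \<le> (?f powr (q - 2) * ?f\<^sup>2) * \<bar>\<alpha>\<bar>"
        by (intro mult_left_mono) auto
      ultimately show ?thesis using True by simp
    next
      case False
      then show ?thesis using bump_outside[OF r False] by simp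
    qed
    finally show ?thesis using C(2)[of 1 c x] by (simp add: distrib_right)
  qed
  define d where "d = (8 / q\<^sup>2) * ((9 / 16) powr q * (- ?Q)) / 2 ^ CARD('n)"
  have d: "d > 0" unfolding d_def using neg q by (intro divide_pos_pos mult_pos_pos) auto
  define M where "M = 18 * (C + \<bar>\<alpha>\<bar>)"
  have M: "M \<ge> 0" using C(1) by (simp add: M_def)
  \<comment> \<open>As \<open>t \<ge> 1\<close>, d t^2 is at least d t = d + M, which exceeds
    M.\<close>
  define t where "t = 1 + M / d"
  have t1: "t \<ge> 1" using M d by (simp add: t_def)
  define u where "u \<delta> = ridge 1 c (log_phase \<mu> \<delta>) (t *\<^sub>R \<xi>)" for \<delta>
  have u: "u \<delta> \<in> C01 \<Omega>" for \<delta>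
    unfolding u_def by (rule ridge_C01[OF r log_phase_has_derivative continuous_log_phase_deriv sub])
  define J where "J x = I (u 0) x + I (u (pi / 2)) x + I (u pi) x + I (u (- (pi / 2))) x" for x
  have J_int: "integrable lborel J"
    unfolding J_def[abs_def] using I_integrable[OF u] by (intro Bochner_Integration.integrable_add)
  have "integral\<^sup>L lborel J = integral\<^sup>L lborel (I (u 0)) + integral\<^sup>L lborel (I (u (pi / 2)))
     + integral\<^sup>L lborel (I (u pi)) + integral\<^sup>L lborel (I (u (- (pi / 2))))"
    unfolding J_def[abs_def] using I_integrable[OF u] by simp
  then have J_nonneg: "0 \<le> integral\<^sup>L lborel J"
    using diss[OF u] by (simp add: add_nonneg_nonneg)
  have "J x \<le> M * indicator (cball c 1) x + (- (d * 2 ^ CARD('n)) * t\<^sup>2) * indicator (ball c (1 / 2)) x" for x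
  proof -
    let ?f = "bump 1 c x"
    have tQ: "(q - 1 + \<mu>\<^sup>2) * ((R *v (t *\<^sub>R \<xi>)) \<bullet> (t *\<^sub>R \<xi>)) - (q - 2) * \<mu> * ((S *v (t *\<^sub>R \<xi>)) \<bullet> (t *\<^sub>R \<xi>)) = t\<^sup>2 * ?Q"
      by (simp add: matrix_vector_mult_scaleR power2_eq_square algebra_simps)
    have "J x = 18 * ridge_energy 1 c (t *\<^sub>R \<xi>) 0 0 x + 8 / q\<^sup>2 * (?f powr (q - 2) * ?f\<^sup>2 * (t\<^sup>2 * ?Q))"
      unfolding J_def u_def tQ[symmetric] by (rule quarter_shift_sum[OF I_log_ridge[OF r sub]])
    also have "\<dots> \<le> 18 * ((C + \<bar>\<alpha>\<bar>) * indicator (cball c 1) x)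
       + 8 / q\<^sup>2 * ((9 / 16) powr q * (t\<^sup>2 * ?Q) * indicator (ball c (1 / 2)) x)"
      using neg by (intro add_mono mult_left_mono K bump_powr_ge_on_half_ball[OF r]) (auto simp: mult_nonneg_nonpos)
    also have "8 / q\<^sup>2 * ((9 / 16) powr q * (t\<^sup>2 * ?Q) * indicator (ball c (1 / 2)) x)
       = (- (d * 2 ^ CARD('n)) * t\<^sup>2) * indicator (ball c (1 / 2)) x"
    proof -
      have "- (d * 2 ^ CARD('n)) = (8 / q\<^sup>2) * ((9 / 16) powr q * ?Q)"
        unfolding d_def by (simp only: mult_minus_right minus_divide_left[symmetric]) simp
      then show ?thesis by (simp add: mult_ac)
    qed
    finally show ?thesis by (simp only: M_def mult.assoc)
  qed
  from integral_le_two_balls[OF J_int r this]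
  have "integral\<^sup>L lborel J \<le> (M - d * t\<^sup>2) * measure lborel (cball c 1)"
    by simp
  with J_nonneg have "0 \<le> (M - d * t\<^sup>2) * measure lborel (cball c 1)" by linarith
  moreover have "measure lborel (cball c 1) > 0" by (rule content_cball_pos) simp
  ultimately have "d * t\<^sup>2 \<le> M" by (simp add: zero_le_mult_iff)
  moreover have "d * t \<le> d * t\<^sup>2"
    using t1 d by (intro mult_left_mono) (auto simp: power2_eq_square)
  moreover have "d * t = d + M" using d by (simp add: t_def distrib_left)
  ultimately show False using d by linarith
qed

lemma nonneg_iff:
  assumes balls: "\<And>r. \<exists>c. cball c r \<subseteq> \<Omega>"
  shows "(\<forall>u\<in>C01 \<Omega>. 0 \<le> integral\<^sup>L lborel (I u)) \<longleftrightarrow>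
    (\<exists>V. 2 *\<^sub>R (R *v V) + \<beta> = 0 \<and> \<alpha> + (R *v V) \<bullet> V \<le> 0) \<and>
    (\<forall>\<xi>. (q - 2) * \<bar>(S *v \<xi>) \<bullet> \<xi>\<bar> \<le> 2 * sqrt (q - 1) * ((R *v \<xi>) \<bullet> \<xi>))"
proof (intro iffI conjI allI ballI)
  assume "\<forall>u\<in>C01 \<Omega>. 0 \<le> integral\<^sup>L lborel (I u)"
  then have diss: "\<And>u. u \<in> C01 \<Omega> \<Longrightarrow> 0 \<le> integral\<^sup>L lborel (I u)" by blast
  show "\<exists>V. 2 *\<^sub>R (R *v V) + \<beta> = 0 \<and> \<alpha> + (R *v V) \<bullet> V \<le> 0"
    using nonneg_quadratic_critical_point[OF R_sym low_frequency_condition[OF diss balls]] by blast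
  fix \<xi> :: "real^'n"
  obtain c where sub: "cball c 1 \<subseteq> \<Omega>" using balls by blast
  \<comment> \<open>With \<mu> = s or -s the coefficient q - 1 + \<mu>^2 equals 2 s^2; dividing by s
    gives the sharpest ratio of the R term to the S term, and the two signs give the absolute
    value.\<close>
  define s where "s = sqrt (q - 1)"
  have s: "s > 0" "q - 1 = s * s" using q by (simp_all add: s_def)
  have "s * ((q - 2) * ((S *v \<xi>) \<bullet> \<xi>)) \<le> s * (2 * s * ((R *v \<xi>) \<bullet> \<xi>))"
    "s * (- ((q - 2) * ((S *v \<xi>) \<bullet> \<xi>))) \<le> s * (2 * s * ((R *v \<xi>) \<bullet> \<xi>))"
    using high_frequency_condition[OF diss sub, of s \<xi>] high_frequency_condition[OF diss sub, of "- s" \<xi>]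
    unfolding s(2) by (simp_all add: algebra_simps power2_eq_square)
  then have "(q - 2) * ((S *v \<xi>) \<bullet> \<xi>) \<le> 2 * s * ((R *v \<xi>) \<bullet> \<xi>)"
    "- ((q - 2) * ((S *v \<xi>) \<bullet> \<xi>)) \<le> 2 * s * ((R *v \<xi>) \<bullet> \<xi>)"
    using s(1) by (simp_all only: mult_le_cancel_left_pos)
  moreover have "(q - 2) * \<bar>(S *v \<xi>) \<bullet> \<xi>\<bar> = \<bar>(q - 2) * ((S *v \<xi>) \<bullet> \<xi>)\<bar>"
    using q by (simp add: abs_mult)
  ultimately show "(q - 2) * \<bar>(S *v \<xi>) \<bullet> \<xi>\<bar> \<le> 2 * sqrt (q - 1) * ((R *v \<xi>) \<bullet> \<xi>)"
    unfolding s_def by (simp only: abs_le_iff)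
next
  fix u assume "(\<exists>V. 2 *\<^sub>R (R *v V) + \<beta> = 0 \<and> \<alpha> + (R *v V) \<bullet> V \<le> 0) \<and>
    (\<forall>\<xi>. (q - 2) * \<bar>(S *v \<xi>) \<bullet> \<xi>\<bar> \<le> 2 * sqrt (q - 1) * ((R *v \<xi>) \<bullet> \<xi>))" "u \<in> C01 \<Omega>"
  then show "0 \<le> integral\<^sup>L lborel (I u)" using integral_nonneg by blast
qed

end

section \<open>Assembly of the cases \<open>p \<ge> 2\<close> and \<open>p < 2\<close>\<close>

theorem theorem2:
  fixes \<Omega> :: "(real^'n::finite) set" and p :: real
    and A :: "complex^'n^'n" and b :: "complex^'n" and a :: complex
  assumes "open \<Omega>"
    and "\<forall>R. \<exists>r\<ge>R. \<exists>c. r > 0 \<and> ball c r \<subseteq> \<Omega>"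
    and "1 < p"
    and "transpose A = A"
  shows "Lp_dissipative p \<Omega> A b a \<longleftrightarrow>
    (\<exists>V :: real^'n.
        2 *\<^sub>R (Re_mat A *v V) + Im_vec b = 0 \<and>
        Re a + (Re_mat A *v V) \<bullet> V \<le> 0) \<and>
    (\<forall>\<xi> :: real^'n.
        \<bar>p - 2\<bar> * \<bar>(Im_mat A *v \<xi>) \<bullet> \<xi>\<bar> \<le> 2 * sqrt (p - 1) * ((Re_mat A *v \<xi>) \<bullet> \<xi>))"
proof -
  note A = assms(4)
  have balls: "\<exists>c. cball c r \<subseteq> \<Omega>" for r
  proof -
    \<comment> \<open>The extra 1 leaves room for a closed ball of radius \<open>r\<close> inside
      the open one.\<close>
    obtain r' c where "r' \<ge> r + 1" "ball c r' \<subseteq> \<Omega>" using assms(2) by blast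
    moreover from this have "cball c r \<subseteq> ball c r'" by auto
    ultimately show ?thesis by blast
  qed
  show ?thesis
  proof (cases "p \<ge> 2")
    case True
    interpret radial_form \<Omega> p "Re_mat A" "Im_mat A" "Re_vec b" "Im_vec b" "Re a"
      "\<lambda>u x. Re (form_integrand A b a u (duality_map p u) x)"
    proof
      show "Re (form_integrand A b a u (duality_map p u) x) = 0" if "u x = 0" "\<And>j. partial_deriv j u x = 0" for u x
        using form_integrand_critical_zero[of u x] that by simp
      show "integrable lborel (\<lambda>x. Re (form_integrand A b a u (duality_map p u) x))" if "u \<in> C01 \<Omega>" for u
        by (intro integrable_Re integrable_form_integrand[OF that] C01_duality_map[OF True that])
    qed (use True transpose_Re_mat[OF A] transpose_Im_mat[OF A] Re_form_integrand_right[OF A True]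
        Re_form_integrand_zero_nonneg[OF A True] in auto)
    have "Lp_dissipative p \<Omega> A b a \<longleftrightarrow> (\<forall>u\<in>C01 \<Omega>. 0 \<le> integral\<^sup>L lborel
        (\<lambda>x. Re (form_integrand A b a u (duality_map p u) x)))"
      using True by (simp add: Lp_dissipative_def Lp_dissipative_form_def Re_sesq_form[OF _ C01_duality_map[OF True]])
    then show ?thesis unfolding nonneg_iff[OF balls] using True by simp
  next
    case False
    define q where "q = p / (p - 1)"
    have q: "q \<ge> 2" using False assms(3) by (simp add: q_def field_simps)
    interpret radial_form \<Omega> q "Re_mat A" "- Im_mat A" "(q - 1) *\<^sub>R Re_vec b" "Im_vec b" "Re a"
      "\<lambda>u x. Re (form_integrand A b a (duality_map q u) u x)"
    proof
      have "transpose (- Im_mat A) = - transpose (Im_mat A)" by (simp add: transpose_def vec_eq_iff)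
      then show "transpose (- Im_mat A) = - Im_mat A" by (simp add: transpose_Im_mat[OF A])
      show "Re (form_integrand A b a (duality_map q u) u x) = 0" if "u x = 0" "\<And>j. partial_deriv j u x = 0" for u x
        using form_integrand_critical_zero[of u x] that by simp
      show "integrable lborel (\<lambda>x. Re (form_integrand A b a (duality_map q u) u x))" if "u \<in> C01 \<Omega>" for u
        by (intro integrable_Re integrable_form_integrand[OF _ that] C01_duality_map[OF q that])
    qed (use q transpose_Re_mat[OF A] Re_form_integrand_left[OF A q]
        Re_form_integrand_zero_nonneg[OF A q] in auto)
    have "Lp_dissipative p \<Omega> A b a \<longleftrightarrow> (\<forall>u\<in>C01 \<Omega>. 0 \<le> integral\<^sup>L lborel
        (\<lambda>x. Re (form_integrand A b a (duality_map q u) u x)))"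
      using False assms(3)
      by (simp add: Lp_dissipative_def Lp_dissipative_form_def q_def[symmetric] Re_sesq_form[OF C01_duality_map[OF q]])
    \<comment> \<open>The inequality is invariant under passing to the conjugate exponent:
      multiplication by p-1 > 0 turns q-2 into |p-2| and sqrt(q-1) into sqrt(p-1), and the absolute
      value hides the sign of \<open>Im_mat A\<close>.\<close>
    moreover have "(q - 2) * \<bar>(- Im_mat A *v \<xi>) \<bullet> \<xi>\<bar> \<le> 2 * sqrt (q - 1) * ((Re_mat A *v \<xi>) \<bullet> \<xi>)
      \<longleftrightarrow> \<bar>p - 2\<bar> * \<bar>(Im_mat A *v \<xi>) \<bullet> \<xi>\<bar> \<le> 2 * sqrt (p - 1) * ((Re_mat A *v \<xi>) \<bullet> \<xi>)" for \<xi>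
    proof -
      let ?s = "sqrt (p - 1)"
      have s: "?s > 0" "p - 1 = ?s * ?s" using assms(3) by simp_all
      have "q - 2 = \<bar>p - 2\<bar> / (p - 1)" "q - 1 = 1 / (p - 1)"
        using False assms(3) by (simp_all add: q_def field_simps)
      then have c: "(q - 2) * (p - 1) = \<bar>p - 2\<bar>" "sqrt (q - 1) * (p - 1) = ?s"
        using s assms(3) by (simp_all add: real_sqrt_divide real_div_sqrt)
      have "(p - 1) * ((q - 2) * X) = \<bar>p - 2\<bar> * X" "(p - 1) * (2 * sqrt (q - 1) * X) = 2 * ?s * X" for X
        unfolding c[symmetric] by (simp_all only: mult_ac)
      moreover have "(q - 2) * \<bar>(- Im_mat A *v \<xi>) \<bullet> \<xi>\<bar> \<le> 2 * sqrt (q - 1) * ((Re_mat A *v \<xi>) \<bullet> \<xi>)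
        \<longleftrightarrow> (p - 1) * ((q - 2) * \<bar>(Im_mat A *v \<xi>) \<bullet> \<xi>\<bar>) \<le> (p - 1) * (2 * sqrt (q - 1) * ((Re_mat A *v \<xi>) \<bullet> \<xi>))"
        using assms(3) by (simp add: minus_matrix_vector_mult mult.assoc)
      ultimately show ?thesis by (simp only:)
    qed
    ultimately show ?thesis unfolding nonneg_iff[OF balls] by simp
  qed
qed

end
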